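(* Let $\tau>0$, let $A$ be a real symmetric $m\times m$ matrix with eigenvalues $0>\lambda_1\ge\lambda_2\ge\dots\ge\lambda_m$, and let $f:\mathbb R\times\mathbb R^m\to\mathbb R^m$, $g:\mathbb R\times\mathbb R^m\to\mathbb R^{m\times d}$ satisfy $f(t+\tau,x)=f(t,x)$, $g(t+\tau,x)=g(t,x)$ for all $t\in\mathbb R$, $x\in\mathbb R^m$. Assume there are constants $C_0,\beta_1,\beta_2>0$ with $\beta_1+\frac{\beta_2^2}{2}<|\lambda_1|$ such that for all $s,t\in\mathbb R$, $x,y\in\mathbb R^m$, $$|f(s,x)-f(t,y)|\le C_0|s-t|^{1/2}+\beta_1|x-y|,\qquad |g(s,x)-g(t,y)|\le C_0|s-t|^{1/2}+\beta_2|x-y|.$$ Let $\Delta t=\tau/n$, $n\in\mathbb N$, be fixed and small enough. Then for every $r\ge 0$ there exists $\widehat X_r^*=\widehat X^*(r,\cdot)\in L^2(\Omega)$ such that for any initial value $\xi$ for which there is a constant $K^*>0$ with $\|\xi\|_2\le K^*$, the solution $\widehat X_r^{-k\tau}(\xi)$ of the Euler-Maruyama scheme with step $\Delta t$ started from $\xi$ at time $-k\tau$ satisfies $$\lim_{k\to\infty}\|\widehat X_r^{-k\tau}(\xi)-\widehat X_r^*\|_2=0,$$ and $\widehat X^*$ satisfies the random periodicity property $\widehat X^*(r+\tau,\omega)=\widehat X^*(r,\theta_\tau\omega)$ $\mathbb P$-a.s., for $r\ge0$.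
   Context: $|\cdot|$ is the Euclidean norm of vectors and the Frobenius norm of matrices; $\|\xi\|_p=(\mathbb E|\xi|^p)^{1/p}$. $W$ is a two-sided Wiener process in $\mathbb R^d$ on $(\Omega,\mathcal F,\mathbb P)$, $\mathcal F^t=\bigvee_{s\le t}\sigma\{W_u-W_v:s\le v\le u\le t\}$, and $\theta_t$ is the $\mathbb P$-preserving Wiener shift $\theta_t(\omega)(s)=W(t+s)-W(t)$. The initial value $\xi$ at time $-k\tau$ is always $\mathcal F^{-k\tau}$-measurable (for each $k\in\mathbb N$ used). Euler-Maruyama scheme: $\Delta t=\tau/n$ with $\Delta t\le 1/\rho$, $\rho=|\lambda_m|$. Set $\widehat X_{-k\tau}^{-k\tau}=\xi$ and, for $i=0,1,2,\dots$, $$\widehat X_{-k\tau+(i+1)\Delta t}^{-k\tau}=\widehat X_{-k\tau+i\Delta t}^{-k\tau}+A\widehat X_{-k\tau+i\Delta t}^{-k\tau}\Delta t+f(i\Delta t,\widehat X_{-k\tau+i\Delta t}^{-k\tau})\Delta t+g(i\Delta t,\widehat X_{-k\tau+i\Delta t}^{-k\tau})\big(W_{-k\tau+(i+1)\Delta t}-W_{-k\tau+i\Delta t}\big).$$ For $r\ge0$ let $N'$ be the integer with $N'\Delta t\le r<(N'+1)\Delta t$; if $r=N'\Delta t$ then $\widehat X_r^{-k\tau}$ is the Euler-Maruyama iterate $\widehat X_{-k\tau+i\Delta t}^{-k\tau}$ with $i=kn+N'$ (so that $-k\tau+i\Delta t=N'\Delta t$), and if $N'\Delta t<r$ then $$\widehat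 X_r^{-k\tau}=\widehat X_{N'\Delta t}^{-k\tau}+f(N'\Delta t,\widehat X_{N'\Delta t}^{-k\tau})(r-N'\Delta t)+g(N'\Delta t,\widehat X_{N'\Delta t}^{-k\tau})(W_r-W_{N'\Delta t}).$$ *)

theory Defs
  imports "HOL-Probability.Probability"
begin

text \<open>
  Vectors are elements of \<^typ>\<open>real ^ 'm\<close>, matrices with rows indexed by \<open>'m\<close> and columns indexed
  by \<open>'d\<close> are elements of \<^typ>\<open>real ^ 'd ^ 'm\<close>. The library norm is the Euclidean norm on the former
  and the Frobenius norm on the latter.
\<close>

text \<open>
  The eigenvalues of \<open>A\<close>, repeated according to their multiplicity as roots of the characteristic
  polynomial and listed in decreasing order as \<open>eig 1 \<ge> \<dots> \<ge> eig m\<close> where \<open>m = CARD('m)\<close>. Here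
  \<^term>\<open>mat x\<close> is the scalar matrix \<open>x I\<close>. Values of \<open>eig\<close> at other indices are irrelevant.
\<close>

definition ordered_eigenvalues :: "real ^ 'm ^ 'm \<Rightarrow> (nat \<Rightarrow> real) \<Rightarrow> bool" where
  "ordered_eigenvalues A eig \<longleftrightarrow>
     (\<forall>x. det (mat x - A) = (\<Prod>i = 1..CARD('m). (x - eig i))) \<and>
     (\<forall>i j. 1 \<le> i \<and> i \<le> j \<and> j \<le> CARD('m) \<longrightarrow> eig j \<le> eig i)"

text \<open>
  The norm \<open>(E |X|^p)^(1/p)\<close> takes values in the extended nonnegative reals, so that it is infinite
  (and not a default value of the Bochner integral) if the \<open>p\<close>-th moment is infinite.
\<close>

definition Lp_norm :: "'w measure \<Rightarrow> real \<Rightarrow> ('w \<Rightarrow> 'b::real_normed_vector) \<Rightarrow> ennreal" where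
  "Lp_norm M p X =
     (let I = (\<integral>\<^sup>+ \<omega>. ennreal (norm (X \<omega>) powr p) \<partial>M)
      in if I = \<infinity> then \<infinity> else ennreal (enn2real I powr (1 / p)))"

definition L2_space :: "'w measure \<Rightarrow> ('w \<Rightarrow> 'b::real_normed_vector) set" where
  "L2_space M = {X \<in> borel_measurable M. Lp_norm M 2 X < \<infinity>}"

locale two_sided_wiener_process = prob_space M
  for M :: "'w measure" +
  fixes W :: "real \<Rightarrow> 'w \<Rightarrow> real ^ 'd"
  assumes measurable_W: "\<And>t. W t \<in> borel_measurable M"
    and W_zero: "AE \<omega> in M. W 0 \<omega> = 0"
    and continuous_paths: "AE \<omega> in M. continuous_on UNIV (\<lambda>t. W t \<omega>)"
    and independent_increments:
      "\<And>(t :: nat \<Rightarrow> real) N. strict_mono_on {..N} t \<Longrightarrow>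
         indep_vars (\<lambda>_. borel) (\<lambda>i \<omega>. W (t (Suc i)) \<omega> - W (t i) \<omega>) {..<N}"
    \<comment> \<open>\<open>W t - W s\<close> has law \<open>N(0, (t - s) I)\<close>\<close>
    and increment_components_indep:
      "\<And>s t. s < t \<Longrightarrow> indep_vars (\<lambda>_. borel) (\<lambda>j \<omega>. (W t \<omega> - W s \<omega>) $ j) UNIV"
    and increment_components_normal:
      "\<And>s t j. s < t \<Longrightarrow>
         distributed M lborel (\<lambda>\<omega>. (W t \<omega> - W s \<omega>) $ j) (normal_density 0 (sqrt (t - s)))"

definition wiener_filtration ::
  "'w measure \<Rightarrow> (real \<Rightarrow> 'w \<Rightarrow> real ^ 'd) \<Rightarrow> real \<Rightarrow> 'w measure" where
  "wiener_filtration M W t =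
     sigma (space M)
       {(\<lambda>\<omega>. W u \<omega> - W v \<omega>) -` B \<inter> space M | u v B. v \<le> u \<and> u \<le> t \<and> B \<in> sets borel}"

text \<open>
  On the canonical path space, where \<open>W s \<omega> = \<omega> s\<close>, the second condition is the pointwise definition
  \<open>(\<theta> t \<omega>) s = W (t + s) \<omega> - W t \<omega>\<close> of the shift.
\<close>

definition wiener_shift ::
  "'w measure \<Rightarrow> (real \<Rightarrow> 'w \<Rightarrow> real ^ 'd) \<Rightarrow> (real \<Rightarrow> 'w \<Rightarrow> 'w) \<Rightarrow> bool" where
  "wiener_shift M W \<theta> \<longleftrightarrow>
     (\<forall>t. \<theta> t \<in> measurable M M \<and> distr M M (\<theta> t) = M) \<and>
     (\<forall>t s. \<forall>\<omega>\<in>space M. W s (\<theta> t \<omega>) = W (t + s) \<omega> - W t \<omega>)"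

text \<open>
  The \<open>i\<close>-th iterate of the scheme with step \<open>h\<close> and initial value \<open>\<xi>\<close> at time \<open>s\<close>, that is, its
  value at time \<open>s + i h\<close>. The coefficients are evaluated at the elapsed time \<open>i h\<close>; in the use below
  \<open>s\<close> is a multiple of their period.
\<close>

primrec em_iterate ::
  "real ^ 'm ^ 'm \<Rightarrow> (real \<Rightarrow> real ^ 'm \<Rightarrow> real ^ 'm) \<Rightarrow> (real \<Rightarrow> real ^ 'm \<Rightarrow> real ^ 'd ^ 'm) \<Rightarrow>
   (real \<Rightarrow> 'w \<Rightarrow> real ^ 'd) \<Rightarrow> real \<Rightarrow> real \<Rightarrow> ('w \<Rightarrow> real ^ 'm) \<Rightarrow> nat \<Rightarrow> 'w \<Rightarrow> real ^ 'm" where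
  "em_iterate A f g W h s \<xi> 0 \<omega> = \<xi> \<omega>"
| "em_iterate A f g W h s \<xi> (Suc i) \<omega> =
     (let x = em_iterate A f g W h s \<xi> i \<omega>; t = real i * h
      in x + h *\<^sub>R (A *v x) + h *\<^sub>R f t x
           + g t x *v (W (s + real (Suc i) * h) \<omega> - W (s + real i * h) \<omega>))"

text \<open>
  The solution at time \<open>r \<ge> 0\<close> of the scheme with step \<open>h = \<tau> / n\<close> started from \<open>\<xi>\<close> at time \<open>- k \<tau>\<close>.
  As intended, the interpolation between grid points has no term with \<open>A\<close>.
\<close>

definition em_solution ::
  "real \<Rightarrow> nat \<Rightarrow> real ^ 'm ^ 'm \<Rightarrow> (real \<Rightarrow> real ^ 'm \<Rightarrow> real ^ 'm) \<Rightarrow>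
   (real \<Rightarrow> real ^ 'm \<Rightarrow> real ^ 'd ^ 'm) \<Rightarrow> (real \<Rightarrow> 'w \<Rightarrow> real ^ 'd) \<Rightarrow>
   nat \<Rightarrow> ('w \<Rightarrow> real ^ 'm) \<Rightarrow> real \<Rightarrow> 'w \<Rightarrow> real ^ 'm" where
  "em_solution \<tau> n A f g W k \<xi> r \<omega> =
     (let h = \<tau> / real n; N = nat \<lfloor>r / h\<rfloor>; t = real N * h;
          x = em_iterate A f g W h (- real k * \<tau>) \<xi> (k * n + N) \<omega>
      in if r = t then x
         else x + (r - t) *\<^sub>R f t x + g t x *v (W r \<omega> - W t \<omega>))"

end

theory Submission
  imports Defs
begin

text \<open>
  Two trajectories of the scheme that are driven by the same noise approach each other in mean
  square. In one step of size \<open>h\<close> their difference \<open>D\<close> becomes \<open>(I + h A) D + h \<Delta>f + \<Delta>g \<Delta>W\<close>. For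
  \<open>h \<le> 1 / \<bar>\<lambda>\<^sub>m\<bar>\<close> the spectrum of \<open>I + h A\<close> lies in \<open>[0, 1 - h \<bar>\<lambda>\<^sub>1\<bar>]\<close>, so the part without noise has norm
  at most \<open>(1 - h (\<bar>\<lambda>\<^sub>1\<bar> - \<beta>\<^sub>1)) \<bar>D\<bar>\<close> (\<open>norm_euler_map_le\<close>). The increment \<open>\<Delta>W\<close> is independent of the past
  and centred, so the two parts are orthogonal and the noise contributes at most \<open>h \<beta>\<^sub>2\<^sup>2 E \<bar>D\<bar>\<^sup>2\<close>
  (\<open>mean_square_past_increment\<close>). Altogether \<open>E \<bar>D\<bar>\<^sup>2\<close> is multiplied in each step by at most
  \<open>q = (1 - h (\<bar>\<lambda>\<^sub>1\<bar> - \<beta>\<^sub>1))\<^sup>2 + h \<beta>\<^sub>2\<^sup>2 = 1 - 2 h (\<bar>\<lambda>\<^sub>1\<bar> - \<beta>\<^sub>1 - \<beta>\<^sub>2\<^sup>2 / 2) + O(h\<^sup>2)\<close>. The coefficient of \<open>h\<close> is negative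
  by assumption, and hence \<open>q < 1\<close> for small \<open>h\<close>.

  The limit is constructed from the trajectories that start at \<open>0\<close> at the times \<open>- k \<tau>\<close>. Since the
  coefficients are periodic, the one that starts at \<open>- (k + 1) \<tau>\<close> is, from time \<open>- k \<tau>\<close> on, a
  trajectory that starts at \<open>- k \<tau>\<close> with the value reached after one period. The shift preserves
  the measure, so the second moment of that value does not depend on \<open>k\<close>. By contraction the
  trajectories for \<open>k\<close> and \<open>k + 1\<close> differ at time \<open>r\<close> by \<open>O(q\<^bsup>n k\<^esup>)\<close> in mean square
  (\<open>solution0_increment\<close>). A sequence with geometrically small steps converges almost surely and in
  mean square to its pathwise limit (\<open>mean_square_lim_le\<close>), and contraction transfers the
  convergence to every other initial value.

  Shifting the path by \<open>\<tau>\<close> turns the trajectory started at \<open>- (k + 1) \<tau>\<close>, observed at \<open>r\<close>, into the one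
  started at \<open>- k \<tau>\<close>, observed at \<open>r + \<tau>\<close>. The two sequences whose limits define \<open>X\<^sup>*(r + \<tau>, \<omega>)\<close> and
  \<open>X\<^sup>*(r, \<theta>\<^sub>\<tau> \<omega>)\<close> are thus the same up to an index shift, which gives random periodicity for every
  path (\<open>pullback_limit_periodic\<close>).
\<close>

section \<open>The norm of the linear part\<close>

text \<open>
  This reduces a bound on the norm of \<open>I + h A\<close> to bounds on the roots of a characteristic polynomial. If the norm \<open>\<sigma>\<close> is attained at the unit
  vector \<open>u\<close>, then Cauchy-Schwarz is sharp in \<open>\<bar>L u\<bar>\<^sup>2 = \<langle>L (L u), u\<rangle>\<close>, so \<open>L (L u) = \<sigma>\<^sup>2 u\<close>. By
  \<open>(L - \<sigma>) (L + \<sigma>) u = 0\<close> either \<open>L u + \<sigma> u\<close> is an eigenvector for \<open>\<sigma>\<close>, or it vanishes and \<open>u\<close> is one for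
  \<open>- \<sigma>\<close>.
\<close>

lemma selfadjoint_norm_attained:
  fixes L :: "'a::euclidean_space \<Rightarrow> 'a"
  assumes lin: "linear L" and sa: "\<And>x y. L x \<bullet> y = x \<bullet> L y"
  obtains \<sigma> v where "\<And>x. norm (L x) \<le> \<sigma> * norm x" and "v \<noteq> 0"
    and "L v = \<sigma> *\<^sub>R v \<or> L v = (- \<sigma>) *\<^sub>R v"
proof -
  interpret L: linear L by fact
  have cont: "continuous_on (sphere 0 1) (\<lambda>x. norm (L x))"
    by (intro continuous_on_norm linear_continuous_on linear_conv_bounded_linear[THEN iffD1] lin)
  have ne: "sphere (0::'a) 1 \<noteq> {}"
    by simp
  obtain u where u: "norm u = 1" and max: "\<And>x. norm x = 1 \<Longrightarrow> norm (L x) \<le> norm (L u)"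
    using continuous_attains_sup[OF compact_sphere ne cont] by auto
  define \<sigma> where "\<sigma> = norm (L u)"
  have le: "norm (L x) \<le> \<sigma> * norm x" for x
  proof (cases "x = 0")
    case False
    have "norm (L (x /\<^sub>R norm x)) \<le> \<sigma>"
      unfolding \<sigma>_def using False by (intro max) simp
    then show ?thesis
      using False by (simp add: L.scaleR field_simps)
  qed (simp add: L.zero)
  have "L (L u) \<bullet> u = (norm (L u))\<^sup>2"
    using sa[of "L u" u] by (simp add: power2_norm_eq_inner)
  moreover have "(norm (a - c *\<^sub>R u))\<^sup>2 = (norm a)\<^sup>2 - 2 * c * (a \<bullet> u) + c\<^sup>2 * (norm u)\<^sup>2" for a c
    unfolding power2_norm_eq_inner
    by (simp add: inner_diff_left inner_diff_right inner_commute[of u a] power2_eq_square algebra_simps)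
  ultimately have "(norm (L (L u) - \<sigma>\<^sup>2 *\<^sub>R u))\<^sup>2
      = (norm (L (L u)))\<^sup>2 - 2 * \<sigma>\<^sup>2 * (norm (L u))\<^sup>2 + (\<sigma>\<^sup>2)\<^sup>2"
    using u by simp
  also have "\<dots> \<le> (\<sigma> * \<sigma>)\<^sup>2 - 2 * \<sigma>\<^sup>2 * \<sigma>\<^sup>2 + (\<sigma>\<^sup>2)\<^sup>2"
    using power_mono[OF le[of "L u"], of 2] by (simp add: \<sigma>_def)
  also have "\<dots> = 0"
    by (simp add: power2_eq_square)
  finally have sq: "L (L u) = \<sigma>\<^sup>2 *\<^sub>R u"
    by simp
  \<comment> \<open>\<open>L\<close> maps \<open>w\<close> to \<open>\<sigma> w\<close>, so \<open>w\<close> is an eigenvector for \<open>\<sigma>\<close> unless it vanishes.\<close>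
  define w where "w = L u + \<sigma> *\<^sub>R u"
  show ?thesis
  proof (cases "w = 0")
    case True
    then have "L u = (- \<sigma>) *\<^sub>R u"
      by (simp add: w_def eq_neg_iff_add_eq_0)
    with u show ?thesis
      by (intro that[OF le, of u]) auto
  next
    case False
    have "L w = \<sigma> *\<^sub>R w"
      unfolding w_def by (simp add: L.add L.scaleR sq power2_eq_square algebra_simps)
    with False show ?thesis
      by (intro that[OF le, of w]) auto
  qed
qed

lemma det_eq_0_if_eigenvector:
  fixes A :: "real ^ 'm ^ 'm"
  assumes "v \<noteq> 0" and "A *v v = \<mu> *\<^sub>R v"
  shows "det (mat \<mu> - A) = 0"
proof -
  have mat: "mat \<mu> *v v = \<mu> *\<^sub>R v"
    by (simp add: matrix_vector_mult_def mat_def vec_eq_iff if_distrib if_distribR cong: if_cong)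
  have "(mat \<mu> - A) *v v = 0"
    by (simp add: matrix_vector_mult_diff_rdistrib assms(2) mat)
  with assms(1) show ?thesis
    using invertible_det_nz[of "mat \<mu> - A"] by (metis invertible_left_inverse matrix_left_invertible_ker)
qed

text \<open>
  The eigenvalues of \<open>I + h A\<close> are the numbers \<open>1 + h \<lambda>\<^sub>i\<close>. The bound on the step makes the smallest of them
  nonnegative, so the largest one determines the norm.
\<close>

lemma norm_euler_map_le:
  fixes A :: "real ^ 'm ^ 'm"
  assumes sym: "transpose A = A" and eig: "ordered_eigenvalues A eig" and neg: "eig 1 < 0"
    and h: "0 < h" "h \<le> 1 / \<bar>eig CARD('m)\<bar>"
  shows "norm (x + h *\<^sub>R (A *v x)) \<le> (1 + h * eig 1) * norm x" and "0 \<le> 1 + h * eig 1"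
proof -
  have card: "1 \<le> CARD('m)"
    by simp
  have mono: "eig CARD('m) \<le> eig i \<and> eig i \<le> eig 1" if "i \<in> {1..CARD('m)}" for i
    using eig that by (auto simp: ordered_eigenvalues_def)
  have last: "eig CARD('m) < 0"
    using mono[of "CARD('m)"] card neg by auto
  have ge: "0 \<le> 1 + h * eig i" if "i \<in> {1..CARD('m)}" for i
  proof -
    have "h * \<bar>eig CARD('m)\<bar> \<le> 1"
      using h(2) last by (simp add: field_simps)
    moreover have "h * eig CARD('m) \<le> h * eig i"
      using mono[OF that] h by simp
    ultimately show ?thesis
      using last by simp
  qed
  show "0 \<le> 1 + h * eig 1"
    using ge[of 1] card by simp
  let ?L = "\<lambda>x. x + h *\<^sub>R (A *v x)"
  have lin: "linear ?L"
    by (rule linearI) (simp_all add: matrix_vector_right_distrib matrix_vector_mult_scaleR algebra_simps)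
  have sa: "?L x \<bullet> y = x \<bullet> ?L y" for x y
    using dot_lmul_matrix[of x A y] transpose_matrix_vector[of A x]
    by (simp add: inner_add sym)
  obtain \<sigma> v where le: "\<And>x. norm (?L x) \<le> \<sigma> * norm x" and v: "v \<noteq> 0"
    and ev: "?L v = \<sigma> *\<^sub>R v \<or> ?L v = (- \<sigma>) *\<^sub>R v"
    using selfadjoint_norm_attained[OF lin sa] by metis
  obtain s where s: "?L v = s *\<^sub>R v" "\<bar>s\<bar> = \<bar>\<sigma>\<bar>"
    using ev by (metis abs_minus_cancel)
  have "0 \<le> \<sigma> * norm v"
    using le[of v] norm_ge_zero order_trans by blast
  then have \<sigma>: "\<sigma> = \<bar>s\<bar>"
    using v s(2) by (simp add: zero_le_mult_iff)
  have "h *\<^sub>R (A *v v) = (s - 1) *\<^sub>R v"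
    using s(1) by (simp add: scaleR_diff_left eq_diff_eq add.commute)
  then have "inverse h *\<^sub>R (h *\<^sub>R (A *v v)) = inverse h *\<^sub>R ((s - 1) *\<^sub>R v)"
    by simp
  then have "A *v v = ((s - 1) / h) *\<^sub>R v"
    using h by (simp add: divide_inverse mult.commute)
  from det_eq_0_if_eigenvector[OF v this] eig
  obtain i where i: "i \<in> {1..CARD('m)}" "(s - 1) / h = eig i"
    by (auto simp: ordered_eigenvalues_def)
  then have "s = 1 + h * eig i"
    using h by (simp add: field_simps)
  then have "\<sigma> = 1 + h * eig i"
    using \<sigma> ge[OF i(1)] by simp
  also have "\<dots> \<le> 1 + h * eig 1"
    using mono[OF i(1)] h by simp
  finally show "norm (?L x) \<le> (1 + h * eig 1) * norm x"
    by (intro order_trans[OF le[of x]] mult_right_mono) auto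
qed

section \<open>Sequences with geometrically small steps\<close>

text \<open>
  Cauchy-Schwarz for the weights \<open>\<surd>p\<^sup>j\<close> bounds the distance of two members of a sequence by a
  weighted sum of squared steps. The sum is linear in the squares and so can be integrated term by term;
  the first factor is a tail of a geometric series.
\<close>

lemma norm_diff_le_weighted_sum:
  fixes X :: "nat \<Rightarrow> 'b::real_normed_vector"
  assumes p: "0 < p" "p < 1" and "k \<le> l"
  shows "(norm (X l - X k))\<^sup>2 \<le> p ^ k / (1 - p) * (\<Sum>j=k..<l. (norm (X (Suc j) - X j))\<^sup>2 / p ^ j)"
proof -
  let ?d = "\<lambda>j. norm (X (Suc j) - X j)"
  have "norm (X l - X k) = norm (\<Sum>j=k..<l. X (Suc j) - X j)"
    using \<open>k \<le> l\<close> by (simp add: sum_Suc_diff')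
  also have "\<dots> \<le> (\<Sum>j=k..<l. sqrt (p ^ j) * (?d j / sqrt (p ^ j)))"
    using p by (intro sum_norm_le) simp
  finally have "(norm (X l - X k))\<^sup>2 \<le> (\<Sum>j=k..<l. sqrt (p ^ j) * (?d j / sqrt (p ^ j)))\<^sup>2"
    by (rule power_mono) simp
  also have "\<dots> \<le> (\<Sum>j=k..<l. (sqrt (p ^ j))\<^sup>2) * (\<Sum>j=k..<l. (?d j / sqrt (p ^ j))\<^sup>2)"
    by (rule Cauchy_Schwarz_ineq_sum)
  also have "\<dots> = (\<Sum>j=k..<l. p ^ j) * (\<Sum>j=k..<l. (?d j)\<^sup>2 / p ^ j)"
    using p by (simp add: power_divide)
  also have "(\<Sum>j=k..<l. p ^ j) = (p ^ k - p ^ l) / (1 - p)"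
  proof -
    have "(\<Sum>j=k..<l. p ^ j) * (1 - p) = p ^ k - p ^ l"
      using \<open>k \<le> l\<close> by (induction l rule: dec_induct) (simp_all add: distrib_right, simp add: algebra_simps)
    then show ?thesis
      using p by (simp add: eq_divide_eq)
  qed
  also have "\<dots> * (\<Sum>j=k..<l. (?d j)\<^sup>2 / p ^ j) \<le> p ^ k / (1 - p) * (\<Sum>j=k..<l. (?d j)\<^sup>2 / p ^ j)"
    using p by (intro mult_right_mono divide_right_mono sum_nonneg) auto
  finally show ?thesis .
qed

lemma lim_of_weighted_sum:
  fixes X :: "nat \<Rightarrow> 'b::banach"
  assumes p: "0 < p" "p < 1"
    and S: "(\<Sum>j. ennreal ((norm (X (Suc j) - X j))\<^sup>2 / p ^ j)) \<le> ennreal S" "0 \<le> S"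
  shows "(norm (X k - lim X))\<^sup>2 \<le> p ^ k / (1 - p) * S"
proof -
  have part: "(\<Sum>j=k..<l. (norm (X (Suc j) - X j))\<^sup>2 / p ^ j) \<le> S" for k l
  proof -
    have "ennreal (\<Sum>j=k..<l. (norm (X (Suc j) - X j))\<^sup>2 / p ^ j)
        = (\<Sum>j=k..<l. ennreal ((norm (X (Suc j) - X j))\<^sup>2 / p ^ j))"
      using p by (simp add: sum_ennreal)
    also have "\<dots> \<le> (\<Sum>j. ennreal ((norm (X (Suc j) - X j))\<^sup>2 / p ^ j))"
      by (rule sum_le_suminf) auto
    also have "\<dots> \<le> ennreal S"
      by fact
    finally show ?thesis
      using S(2) by simp
  qed
  have bd: "(norm (X l - X k))\<^sup>2 \<le> p ^ k / (1 - p) * S" if "k \<le> l" for k l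
    using p by (intro order_trans[OF norm_diff_le_weighted_sum[OF p that, of X]] mult_left_mono part) auto
  have "(\<lambda>k. p ^ k / (1 - p) * S) \<longlonglongrightarrow> 0 / (1 - p) * S"
    using p by (intro tendsto_intros LIMSEQ_realpow_zero) auto
  then have lim0: "(\<lambda>k. p ^ k / (1 - p) * S) \<longlonglongrightarrow> 0" by simp
  have "Cauchy X"
  proof (rule metric_CauchyI)
    fix e :: real assume e: "e > 0"
    have "\<forall>\<^sub>F k in sequentially. p ^ k / (1 - p) * S < (e / 2)\<^sup>2"
      using lim0 by (rule order_tendstoD) (use e in simp)
    then obtain K where K: "p ^ K / (1 - p) * S < (e / 2)\<^sup>2"
      by (auto simp: eventually_sequentially)
    have "dist (X l) (X K) < e / 2" if "K \<le> l" for l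
      using power2_less_imp_less[OF le_less_trans[OF bd[OF that] K]] e by (simp add: dist_norm)
    then show "\<exists>K. \<forall>i\<ge>K. \<forall>j\<ge>K. dist (X i) (X j) < e"
      by (blast intro: dist_triangle_half_l)
  qed
  then have "X \<longlonglongrightarrow> lim X"
    using Cauchy_convergent convergent_LIMSEQ_iff by blast
  then have "(\<lambda>l. (norm (X l - X k))\<^sup>2) \<longlonglongrightarrow> (norm (lim X - X k))\<^sup>2"
    by (intro tendsto_intros)
  then have "(norm (lim X - X k))\<^sup>2 \<le> p ^ k / (1 - p) * S"
    by (rule LIMSEQ_le_const2) (use bd in blast)
  then show ?thesis
    by (simp add: norm_minus_commute)
qed

section \<open>Independence of the past and the next increment\<close>

lemma strict_mono_enumeration:
  fixes T :: "'a::linorder set"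
  assumes fin: "finite T" and t: "t \<in> T" and max: "\<And>s. s \<in> T \<Longrightarrow> s \<le> t" and "t < u"
  obtains N and e :: "nat \<Rightarrow> 'a"
  where "strict_mono_on {..Suc N} e" and "T = e ` {..N}" and "e N = t" and "e (Suc N) = u"
proof -
  define e where "e i = sorted_list_of_set T ! i" for i
  have mono: "strict_mono_on {..<card T} e"
    unfolding strict_mono_on_def e_def
    by (auto intro!: sorted_wrt_nth_less[OF strict_sorted_list_of_set])
  have img': "T = e ` {..<card T}"
    using fin nth_image[of "card T" "sorted_list_of_set T"] by (simp add: e_def[abs_def] atLeast0LessThan)
  obtain N where N: "card T = Suc N"
    using fin t by (metis card_gt_0_iff empty_iff gr0_implies_Suc)
  then have dom: "{..<card T} = {..N}"
    by auto
  have img: "T = e ` {..N}"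
    using img' unfolding dom .
  obtain i where i: "i \<le> N" "t = e i"
    using t img by auto
  have "\<not> i < N"
  proof
    assume "i < N"
    then have "t < e N"
      unfolding i(2) by (intro strict_mono_onD[OF mono]) (auto simp: N)
    then show False
      using max[of "e N"] img by auto
  qed
  with i have last: "e N = t"
    by simp
  have le: "e j \<le> t" if "j \<le> N" for j
    using that img by (intro max) auto
  show ?thesis
  proof
    show "strict_mono_on {..Suc N} (e(Suc N := u))"
      using mono le \<open>t < u\<close> unfolding dom strict_mono_on_def by (auto simp: le_Suc_eq intro: le_less_trans)
    show "T = (e(Suc N := u)) ` {..N}"
      using img by (auto simp: image_iff)
  qed (use last in auto)
qed

context two_sided_wiener_process begin

lemma space_wiener_filtration [simp]: "space (wiener_filtration M W t) = space M"
  unfolding wiener_filtration_def by (rule space_measure_of) auto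

lemma sets_wiener_filtration:
  "sets (wiener_filtration M W t) = sigma_sets (space M)
     {(\<lambda>\<omega>. W u \<omega> - W v \<omega>) -` B \<inter> space M | u v B. v \<le> u \<and> u \<le> t \<and> B \<in> sets borel}"
  unfolding wiener_filtration_def by (rule sets_measure_of) auto

lemma measurable_increment: "(\<lambda>\<omega>. W u \<omega> - W v \<omega>) \<in> borel_measurable M"
  using measurable_W[of u] measurable_W[of v] by simp

lemma sets_wiener_filtration_subset: "sets (wiener_filtration M W t) \<subseteq> sets M"
  unfolding sets_wiener_filtration
  by (intro sets.sigma_sets_subset) (auto intro!: measurable_sets[OF measurable_increment])

lemma wiener_filtration_mono:
  assumes "s \<le> t" shows "sets (wiener_filtration M W s) \<subseteq> sets (wiener_filtration M W t)"
  unfolding sets_wiener_filtration using assms by (intro sigma_sets_mono') force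

lemma measurable_wiener_filtration_mono:
  assumes "X \<in> measurable (wiener_filtration M W s) N" and "s \<le> t"
  shows "X \<in> measurable (wiener_filtration M W t) N"
  using assms(1) wiener_filtration_mono[OF assms(2)] by (auto simp: measurable_def)

lemma measurable_wiener_filtration_ambient:
  "X \<in> measurable (wiener_filtration M W s) N \<Longrightarrow> X \<in> measurable M N"
  using sets_wiener_filtration_subset by (auto simp: measurable_def)

lemma measurable_wiener_filtration_increment:
  assumes "v \<le> u" "u \<le> t"
  shows "(\<lambda>\<omega>. W u \<omega> - W v \<omega>) \<in> borel_measurable (wiener_filtration M W t)"
proof (rule measurableI)
  fix B :: "(real^'d) set" assume "B \<in> sets borel"
  with assms show "(\<lambda>\<omega>. W u \<omega> - W v \<omega>) -` B \<inter> space (wiener_filtration M W t)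
      \<in> sets (wiener_filtration M W t)"
    unfolding sets_wiener_filtration space_wiener_filtration by (intro sigma_sets.Basic) blast
qed simp

text \<open>
  For finite sets \<open>T\<close> of times with greatest element \<open>t\<close> these sigma-algebras form a directed family. Its
  union is an intersection-stable generator of the filtration at time \<open>t\<close>, so independence of the next
  increment has to be checked for finitely many times only.
\<close>

definition increment_events :: "real set \<Rightarrow> 'w set set" where
  "increment_events T = sigma_sets (space M)
     {(\<lambda>\<omega>. W u \<omega> - W v \<omega>) -` B \<inter> space M | u v B. u \<in> T \<and> v \<in> T \<and> v \<le> u \<and> B \<in> sets borel}"

lemma increment_events_mono: "S \<subseteq> T \<Longrightarrow> increment_events S \<subseteq> increment_events T"
  unfolding increment_events_def by (intro sigma_sets_mono') blast

lemma increment_events_Int: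
  assumes "E \<in> increment_events T" "F \<in> increment_events T"
  shows "E \<inter> F \<in> increment_events T"
proof -
  interpret sigma_algebra "space M" "increment_events T"
    unfolding increment_events_def by (rule sigma_algebra_sigma_sets) auto
  show ?thesis using assms by blast
qed

text \<open>
  Enumerating \<open>T \<union> {u}\<close> in increasing order makes every increment between times in \<open>T\<close> a sum of
  consecutive increments, all of them different from the last one, \<open>W u - W t\<close>.
\<close>

lemma increment_events_indep:
  assumes T: "finite T" "t \<in> T" "T \<subseteq> {..t}" and "t < u"
    and E: "E \<in> increment_events T" and B: "B \<in> sets borel"
  shows "prob (E \<inter> ((\<lambda>\<omega>. W u \<omega> - W t \<omega>) -` B \<inter> space M))
    = prob E * prob ((\<lambda>\<omega>. W u \<omega> - W t \<omega>) -` B \<inter> space M)"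
proof -
  obtain N e where mono: "strict_mono_on {..Suc N} e" and img: "T = e ` {..N}"
    and e: "e N = t" "e (Suc N) = u"
    by (rule strict_mono_enumeration[of T t u]) (use T \<open>t < u\<close> in auto)
  define I where "I i \<omega> = W (e (Suc i)) \<omega> - W (e i) \<omega>" for i \<omega>
  have ind: "indep_vars (\<lambda>_. borel) I {..<Suc N}"
    using independent_increments[OF mono] by (simp add: I_def[abs_def])
  define Y where "Y \<omega> = (\<lambda>i\<in>{..<N}. I i \<omega>)" for \<omega>
  let ?P = "PiM {..<N} (\<lambda>_. borel :: (real^'d) measure)"
  let ?Q = "PiM {N} (\<lambda>_. borel :: (real^'d) measure)"
  have indY: "indep_var ?P Y ?Q (\<lambda>\<omega>. \<lambda>i\<in>{N}. I i \<omega>)"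
    using indep_var_restrict[OF ind, of "{..<N}" "{N}"] by (simp add: Y_def[abs_def])
  let ?V = "vimage_algebra (space M) Y ?P"
  have rvY: "Y \<in> measurable M ?P"
    using indY by (rule indep_var_rv1)
  have "{(\<lambda>\<omega>. W u \<omega> - W v \<omega>) -` B \<inter> space M | u v B. u \<in> T \<and> v \<in> T \<and> v \<le> u \<and> B \<in> sets borel}
      \<subseteq> sets ?V"
  proof safe
    fix u v and B :: "(real^'d) set"
    assume "u \<in> T" "v \<in> T" and "v \<le> u" and B: "B \<in> sets borel"
    then obtain i j where ij: "i \<le> N" "j \<le> N" "u = e i" "v = e j"
      using img by auto
    have "j \<le> i"
      using mono ij \<open>v \<le> u\<close> strict_mono_onD[OF mono, of i j] by force
    have eq: "(\<lambda>\<omega>. W u \<omega> - W v \<omega>) = (\<lambda>\<omega>. \<Sum>l=j..<i. Y \<omega> l)"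
      using \<open>j \<le> i\<close> ij by (auto simp: Y_def I_def sum_Suc_diff'[of j i "\<lambda>i. W (e i) _"] intro!: ext)
    have "(\<lambda>y. \<Sum>l=j..<i. y l) \<in> measurable ?P (borel :: (real^'d) measure)"
      using ij by (intro borel_measurable_sum measurable_component_singleton) auto
    then have "(\<lambda>\<omega>. \<Sum>l=j..<i. Y \<omega> l) \<in> borel_measurable ?V"
      by (rule measurable_compose[rotated]) (intro measurable_vimage_algebra1 measurable_space[OF rvY] Pi_I)
    from measurable_sets[OF this B] show "(\<lambda>\<omega>. W u \<omega> - W v \<omega>) -` B \<inter> space M \<in> sets ?V"
      unfolding eq by simp
  qed
  then have "increment_events T \<subseteq> sets ?V"
    unfolding increment_events_def using sets.sigma_sets_subset[of _ ?V] by simp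
  with E obtain C where C: "C \<in> sets ?P" "E = Y -` C \<inter> space M"
    using sets_vimage_algebra2[of Y "space M" ?P] measurable_space[OF rvY] by auto
  let ?D = "(\<lambda>x. x N) -` B \<inter> space ?Q"
  have D: "?D \<in> sets ?Q"
    using B by (intro measurable_sets[OF measurable_component_singleton]) auto
  have past: "(\<lambda>\<omega>. W u \<omega> - W t \<omega>) -` B \<inter> space M = (\<lambda>\<omega>. \<lambda>i\<in>{N}. I i \<omega>) -` ?D \<inter> space M"
    by (auto simp: I_def e space_PiM)
  show ?thesis
    unfolding past C(2)
    using indep_varD[OF indY C(1) D] by (simp add: vimage_def Int_def conj_ac mem_Times_iff)
qed

lemma indep_set_past_increment:
  assumes "t < u"
  shows "indep_set (sets (wiener_filtration M W t))
    (sigma_sets (space M) {(\<lambda>\<omega>. W u \<omega> - W t \<omega>) -` B \<inter> space M | B. B \<in> sets borel})"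
proof -
  let ?Z = "\<lambda>\<omega>. W u \<omega> - W t \<omega>"
  define \<A> where "\<A> = (\<Union>T\<in>{T. finite T \<and> t \<in> T \<and> T \<subseteq> {..t}}. increment_events T)"
  define \<B> where "\<B> = {?Z -` B \<inter> space M | B. B \<in> sets borel}"
  have ev: "increment_events T \<subseteq> events" for T
    unfolding increment_events_def
    by (intro sets.sigma_sets_subset) (auto intro!: measurable_sets[OF measurable_increment])
  have "indep_set \<A> \<B>"
  proof (rule indep_setI)
    show "\<A> \<subseteq> events"
      using ev by (auto simp: \<A>_def)
    show "\<B> \<subseteq> events"
      by (auto simp: \<B>_def intro!: measurable_sets[OF measurable_increment])
    show "prob (a \<inter> b) = prob a * prob b" if "a \<in> \<A>" "b \<in> \<B>" for a b
      using that increment_events_indep[OF _ _ _ assms] unfolding \<A>_def \<B>_def by blast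
  qed
  moreover have "Int_stable \<A>"
  proof (rule Int_stableI)
    fix E F assume "E \<in> \<A>" "F \<in> \<A>"
    then obtain S T where S: "finite S" "t \<in> S" "S \<subseteq> {..t}" "E \<in> increment_events S"
      and T: "finite T" "t \<in> T" "T \<subseteq> {..t}" "F \<in> increment_events T"
      by (auto simp: \<A>_def)
    then have "E \<inter> F \<in> increment_events (S \<union> T)"
      using increment_events_mono[of S "S \<union> T"] increment_events_mono[of T "S \<union> T"]
      by (intro increment_events_Int) auto
    with S T show "E \<inter> F \<in> \<A>"
      unfolding \<A>_def by (intro UN_I[of "S \<union> T"]) auto
  qed
  moreover have "Int_stable \<B>"
  proof (rule Int_stableI)
    fix E F assume "E \<in> \<B>" "F \<in> \<B>"
    then obtain B C where "B \<in> sets borel" "C \<in> sets borel" "E = ?Z -` B \<inter> space M" "F = ?Z -` C \<inter> space M"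
      by (auto simp: \<B>_def)
    then show "E \<inter> F \<in> \<B>"
      unfolding \<B>_def by (intro CollectI exI[of _ "B \<inter> C"]) auto
  qed
  ultimately have "indep_set (sigma_sets (space M) \<A>) (sigma_sets (space M) \<B>)"
    by (rule indep_set_sigma_sets)
  moreover have "sets (wiener_filtration M W t) \<subseteq> sigma_sets (space M) \<A>"
    unfolding sets_wiener_filtration
  proof (rule sigma_sets_mono', safe)
    fix u v and B :: "(real^'d) set"
    assume *: "v \<le> u" "u \<le> t" "B \<in> sets borel"
    have "(\<lambda>\<omega>. W u \<omega> - W v \<omega>) -` B \<inter> space M \<in> increment_events {v, u, t}"
      unfolding increment_events_def by (intro sigma_sets.Basic) (use * in blast)
    then show "(\<lambda>\<omega>. W u \<omega> - W v \<omega>) -` B \<inter> space M \<in> \<A>"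
      unfolding \<A>_def using * by (intro UN_I[of "{v, u, t}"]) auto
  qed
  ultimately show ?thesis
    unfolding \<B>_def indep_sets2_eq by blast
qed

text \<open>
  Freezing: the increment may be integrated first, with the past held fixed. The predicate \<open>indep_var\<close>
  requires both variables to take values in the same type, whence the embedding of the two spaces into
  their product.
\<close>

lemma nn_integral_past_increment:
  assumes "t < u" and X: "X \<in> borel_measurable (wiener_filtration M W t)"
    and \<phi>: "(\<lambda>(x, z). \<phi> x z) \<in> borel_measurable (borel \<Otimes>\<^sub>M borel)"
  shows "(\<integral>\<^sup>+\<omega>. \<phi> (X \<omega> :: 'x::euclidean_space) (W u \<omega> - W t \<omega>) \<partial>M)
    = (\<integral>\<^sup>+\<omega>. (\<integral>\<^sup>+\<omega>'. \<phi> (X \<omega>) (W u \<omega>' - W t \<omega>') \<partial>M) \<partial>M)"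
proof -
  let ?Z = "\<lambda>\<omega>. W u \<omega> - W t \<omega>"
  let ?X' = "\<lambda>\<omega>. (X \<omega>, 0 :: real^'d)" and ?Z' = "\<lambda>\<omega>. (0 :: 'x, ?Z \<omega>)"
  note [measurable] = \<phi> measurable_wiener_filtration_ambient[OF X] measurable_increment
  have ind: "indep_var borel ?X' borel ?Z'"
    unfolding indep_var_eq
  proof (intro conjI)
    let ?F = "wiener_filtration M W t"
    have X': "?X' \<in> borel_measurable ?F"
      using X by simp
    have "sigma_sets (space M) {?X' -` B \<inter> space M | B. B \<in> sets borel} \<subseteq> sets ?F"
      using sets.sigma_sets_subset[of "{?X' -` B \<inter> space M | B. B \<in> sets borel}" ?F]
        measurable_sets[OF X'] by auto
    moreover have "?Z' -` B \<inter> space M = ?Z -` ((\<lambda>z. (0, z)) -` B) \<inter> space M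
        \<and> (\<lambda>z. (0 :: 'x, z)) -` B \<in> sets (borel :: (real^'d) measure)"
      if "B \<in> sets borel" for B
      using that measurable_sets[of "\<lambda>z::real^'d. (0 :: 'x, z)" borel borel B] by auto
    then have "sigma_sets (space M) {?Z' -` B \<inter> space M | B. B \<in> sets borel}
        \<subseteq> sigma_sets (space M) {?Z -` B \<inter> space M | B. B \<in> sets borel}"
      by (intro sigma_sets_mono') blast
    ultimately show "indep_set (sigma_sets (space M) {?X' -` B \<inter> space M | B. B \<in> sets borel})
        (sigma_sets (space M) {?Z' -` B \<inter> space M | B. B \<in> sets borel})"
      using indep_set_past_increment[OF assms(1)] unfolding indep_sets2_eq by blast
  qed simp_all
  let ?DX = "distr M borel ?X'" and ?DZ = "distr M borel ?Z'"
  interpret DZ: prob_space ?DZ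
    by (rule prob_space_distr) simp
  have [measurable]: "(\<lambda>p. \<phi> (fst (fst p)) (snd (snd p)))
      \<in> borel_measurable ((borel :: ('x \<times> (real^'d)) measure) \<Otimes>\<^sub>M (borel :: ('x \<times> (real^'d)) measure))"
    using measurable_compose[OF _ \<phi>, of "\<lambda>p. (fst (fst p), snd (snd p))"]
    by (simp add: borel_prod[symmetric])
  have slice: "(\<lambda>z :: 'x \<times> (real^'d). \<phi> x (snd z)) \<in> borel_measurable borel" for x
    using measurable_compose[OF _ \<phi>, of "\<lambda>z :: 'x \<times> (real^'d). (x, snd z)" borel]
    by (simp add: borel_prod[symmetric])
  have "(\<integral>\<^sup>+\<omega>. \<phi> (X \<omega>) (?Z \<omega>) \<partial>M)
      = (\<integral>\<^sup>+p. \<phi> (fst (fst p)) (snd (snd p)) \<partial>distr M (borel \<Otimes>\<^sub>M borel) (\<lambda>\<omega>. (?X' \<omega>, ?Z' \<omega>)))"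
    by (subst nn_integral_distr) simp_all
  also have "\<dots> = (\<integral>\<^sup>+p. \<phi> (fst (fst p)) (snd (snd p)) \<partial>(?DX \<Otimes>\<^sub>M ?DZ))"
    using ind unfolding indep_var_distribution_eq by simp
  also have "\<dots> = (\<integral>\<^sup>+x. (\<integral>\<^sup>+z. \<phi> (fst x) (snd z) \<partial>?DZ) \<partial>?DX)"
    by (subst DZ.nn_integral_fst[symmetric]) simp_all
  also have "\<dots> = (\<integral>\<^sup>+\<omega>. (\<integral>\<^sup>+z. \<phi> (X \<omega>) (snd z) \<partial>?DZ) \<partial>M)"
    by (subst nn_integral_distr) simp_all
  also have "\<dots> = (\<integral>\<^sup>+\<omega>. (\<integral>\<^sup>+\<omega>'. \<phi> (X \<omega>) (?Z \<omega>') \<partial>M) \<partial>M)"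
    by (simp add: nn_integral_distr slice)
  finally show ?thesis .
qed

end

section \<open>Second moments\<close>

text \<open>
  An extended nonnegative integral, so that mean-square estimates hold before integrability is known.
\<close>

definition mean_square :: "'w measure \<Rightarrow> ('w \<Rightarrow> 'b::real_normed_vector) \<Rightarrow> ennreal" where
  "mean_square M X = (\<integral>\<^sup>+\<omega>. ennreal ((norm (X \<omega>))\<^sup>2) \<partial>M)"

lemma Lp_norm_2_eq:
  "Lp_norm M 2 X = (if mean_square M X = \<infinity> then \<infinity> else ennreal (sqrt (enn2real (mean_square M X))))"
proof -
  have "(\<integral>\<^sup>+\<omega>. ennreal (norm (X \<omega>) powr 2) \<partial>M) = mean_square M X"
    unfolding mean_square_def by (simp add: powr_numeral)
  then show ?thesis
    by (simp add: Lp_norm_def Let_def powr_half_sqrt)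
qed

lemma Lp_norm_2_le:
  assumes "mean_square M X \<le> ennreal c" "0 \<le> c"
  shows "Lp_norm M 2 X \<le> ennreal (sqrt c)"
proof -
  have "mean_square M X \<noteq> \<infinity>"
    using assms by (metis ennreal_less_top infinity_ennreal_def leD)
  moreover have "enn2real (mean_square M X) \<le> c"
    using assms enn2real_mono[of "mean_square M X" "ennreal c"] by simp
  ultimately show ?thesis
    by (simp add: Lp_norm_2_eq ennreal_leI)
qed

lemma mean_square_finite_if_Lp_norm_le:
  assumes "Lp_norm M 2 X \<le> ennreal K"
  shows "mean_square M X < \<infinity>"
  using assms by (auto simp: Lp_norm_2_eq less_top top_unique split: if_splits)

lemma mean_square_add_le:
  assumes [measurable]: "X \<in> borel_measurable M" "Y \<in> borel_measurable M"
  shows "mean_square M (\<lambda>\<omega>. X \<omega> + Y \<omega> :: 'b::euclidean_space)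
    \<le> 2 * mean_square M X + 2 * mean_square M Y"
proof -
  have sq: "(norm (x + y))\<^sup>2 \<le> 2 * (norm x)\<^sup>2 + 2 * (norm y)\<^sup>2" for x y :: 'b
  proof -
    have "(norm (x + y))\<^sup>2 + (norm (x - y))\<^sup>2 = 2 * (norm x)\<^sup>2 + 2 * (norm y)\<^sup>2"
      unfolding power2_norm_eq_inner by (simp add: inner_add_left inner_add_right inner_diff_left inner_diff_right)
    then show ?thesis
      using zero_le_power2[of "norm (x - y)"] by linarith
  qed
  have "mean_square M (\<lambda>\<omega>. X \<omega> + Y \<omega>)
      \<le> (\<integral>\<^sup>+\<omega>. 2 * ennreal ((norm (X \<omega>))\<^sup>2) + 2 * ennreal ((norm (Y \<omega>))\<^sup>2) \<partial>M)"
    unfolding mean_square_def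
  proof (rule nn_integral_mono)
    fix \<omega>
    have "ennreal ((norm (X \<omega> + Y \<omega>))\<^sup>2) \<le> ennreal (2 * (norm (X \<omega>))\<^sup>2 + 2 * (norm (Y \<omega>))\<^sup>2)"
      using sq by (rule ennreal_leI)
    also have "\<dots> = 2 * ennreal ((norm (X \<omega>))\<^sup>2) + 2 * ennreal ((norm (Y \<omega>))\<^sup>2)"
      by (simp add: ennreal_mult)
    finally show "ennreal ((norm (X \<omega> + Y \<omega>))\<^sup>2) \<le> \<dots>" .
  qed
  also have "\<dots> = 2 * mean_square M X + 2 * mean_square M Y"
    unfolding mean_square_def by (simp add: nn_integral_add nn_integral_cmult)
  finally show ?thesis .
qed

text \<open>
  The mean squares of the steps decay like \<open>p\<^bsup>2 k\<^esup>\<close>, twice the rate of the weights \<open>p\<^bsup>k\<^esup>\<close>. The weighted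
  sum \<open>S\<close> of squared steps is therefore integrable, hence finite almost surely, and the pathwise estimate
  \<open>lim_of_weighted_sum\<close> gives the almost sure convergence and the rate in mean square in one stroke.
\<close>

lemma mean_square_lim_le:
  fixes X :: "nat \<Rightarrow> 'w \<Rightarrow> 'b::euclidean_space"
  assumes [measurable]: "\<And>k. X k \<in> borel_measurable M"
    and p: "0 < p" "p < 1" and c: "0 \<le> c"
    and step: "\<And>k. mean_square M (\<lambda>\<omega>. X (Suc k) \<omega> - X k \<omega>) \<le> ennreal (c * (p\<^sup>2) ^ k)"
  shows "mean_square M (\<lambda>\<omega>. X k \<omega> - lim (\<lambda>k. X k \<omega>)) \<le> ennreal (p ^ k / (1 - p) * (c / (1 - p)))"
proof -
  define S where "S \<omega> = (\<Sum>j. ennreal ((norm (X (Suc j) \<omega> - X j \<omega>))\<^sup>2 / p ^ j))" for \<omega>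
  have [measurable]: "S \<in> borel_measurable M"
    unfolding S_def[abs_def] by measurable
  have term_le: "(\<integral>\<^sup>+\<omega>. ennreal ((norm (X (Suc j) \<omega> - X j \<omega>))\<^sup>2 / p ^ j) \<partial>M) \<le> ennreal (c * p ^ j)" for j
  proof -
    have "(\<integral>\<^sup>+\<omega>. ennreal ((norm (X (Suc j) \<omega> - X j \<omega>))\<^sup>2 / p ^ j) \<partial>M)
        = (\<integral>\<^sup>+\<omega>. ennreal (1 / p ^ j) * ennreal ((norm (X (Suc j) \<omega> - X j \<omega>))\<^sup>2) \<partial>M)"
      using p by (simp add: ennreal_mult'[symmetric])
    also have "\<dots> = ennreal (1 / p ^ j) * mean_square M (\<lambda>\<omega>. X (Suc j) \<omega> - X j \<omega>)"
      unfolding mean_square_def by (rule nn_integral_cmult) simp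
    also have "\<dots> \<le> ennreal (1 / p ^ j) * ennreal (c * (p\<^sup>2) ^ j)"
      by (rule mult_left_mono[OF step]) simp
    also have "\<dots> = ennreal (c * p ^ j)"
      using p by (simp add: ennreal_mult'[symmetric] power2_eq_square power_mult_distrib)
    finally show ?thesis .
  qed
  have "(\<lambda>j. c * p ^ j) sums (c * (1 / (1 - p)))"
    using p by (intro sums_mult geometric_sums) auto
  then have sums: "(\<Sum>j. ennreal (c * p ^ j)) = ennreal (c / (1 - p))"
    using p c by (subst suminf_ennreal_eq[of "\<lambda>j. c * p ^ j" "c / (1 - p)"]) auto
  have "(\<integral>\<^sup>+\<omega>. S \<omega> \<partial>M) = (\<Sum>j. \<integral>\<^sup>+\<omega>. ennreal ((norm (X (Suc j) \<omega> - X j \<omega>))\<^sup>2 / p ^ j) \<partial>M)"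
    unfolding S_def by (rule nn_integral_suminf) measurable
  also have "\<dots> \<le> (\<Sum>j. ennreal (c * p ^ j))"
    by (intro suminf_le term_le) auto
  finally have S_le: "(\<integral>\<^sup>+\<omega>. S \<omega> \<partial>M) \<le> ennreal (c / (1 - p))"
    unfolding sums .
  then have "(\<integral>\<^sup>+\<omega>. S \<omega> \<partial>M) \<noteq> \<infinity>"
    by (metis ennreal_less_top infinity_ennreal_def leD)
  then have "AE \<omega> in M. S \<omega> \<noteq> \<infinity>"
    by (intro nn_integral_PInf_AE) simp_all
  then have "AE \<omega> in M. ennreal ((norm (X k \<omega> - lim (\<lambda>k. X k \<omega>)))\<^sup>2) \<le> ennreal (p ^ k / (1 - p)) * S \<omega>"
  proof eventually_elim
    case (elim \<omega>)
    then obtain s where s: "S \<omega> = ennreal s" "0 \<le> s"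
      by (cases "S \<omega>") auto
    have "(norm (X k \<omega> - lim (\<lambda>k. X k \<omega>)))\<^sup>2 \<le> p ^ k / (1 - p) * s"
      using lim_of_weighted_sum[OF p, of "\<lambda>k. X k \<omega>" s k] s by (simp add: S_def)
    then show ?case
      unfolding s(1) using p s(2) by (simp add: ennreal_mult''[symmetric] ennreal_leI)
  qed
  then have "mean_square M (\<lambda>\<omega>. X k \<omega> - lim (\<lambda>k. X k \<omega>)) \<le> (\<integral>\<^sup>+\<omega>. ennreal (p ^ k / (1 - p)) * S \<omega> \<partial>M)"
    unfolding mean_square_def by (rule nn_integral_mono_AE)
  also have "\<dots> = ennreal (p ^ k / (1 - p)) * (\<integral>\<^sup>+\<omega>. S \<omega> \<partial>M)"
    by (rule nn_integral_cmult) simp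
  also have "\<dots> \<le> ennreal (p ^ k / (1 - p)) * ennreal (c / (1 - p))"
    by (rule mult_left_mono[OF S_le]) simp
  also have "\<dots> = ennreal (p ^ k / (1 - p) * (c / (1 - p)))"
    using p c by (intro ennreal_mult[symmetric]) auto
  finally show ?thesis .
qed

section \<open>Mean-square effect of one noisy step\<close>

lemma borel_measurable_matrix_vector_mult:
  fixes G :: "'w \<Rightarrow> real ^ 'd ^ 'm" and z :: "'w \<Rightarrow> real ^ 'd"
  assumes "G \<in> borel_measurable M" "z \<in> borel_measurable M"
  shows "(\<lambda>\<omega>. G \<omega> *v z \<omega>) \<in> borel_measurable M"
proof (rule borel_measurable_continuous_Pair[OF assms])
  show "continuous_on UNIV (\<lambda>x :: (real ^ 'd ^ 'm) \<times> (real ^ 'd). fst x *v snd x)"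
    unfolding matrix_vector_mult_def by (intro continuous_intros)
qed

lemma power2_norm_vec: "(norm (x :: real ^ 'n))\<^sup>2 = (\<Sum>i\<in>UNIV. (x $ i)\<^sup>2)"
  unfolding power2_norm_eq_inner inner_vec_def by (simp add: power2_eq_square)

lemma power2_norm_matrix: "(norm (G :: real ^ 'd ^ 'm))\<^sup>2 = (\<Sum>i\<in>UNIV. \<Sum>j\<in>UNIV. (G $ i $ j)\<^sup>2)"
  unfolding power2_norm_eq_inner inner_vec_def by (simp add: power2_eq_square)

context two_sided_wiener_process begin

lemma increment_moment1:
  assumes "t < u"
  shows "has_bochner_integral M (\<lambda>\<omega>. (W u \<omega> - W t \<omega>) $ j) 0"
  using normal_distributed_expectation[OF _ increment_components_normal[OF assms, of j]]
    distributed_integrable_var[OF increment_components_normal[OF assms, of j]]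
    integrable_normal_moment_nz_1[of "sqrt (u - t)" 0] assms
  by (simp add: has_bochner_integral_iff)

lemma increment_moment2:
  assumes "t < u"
  shows "has_bochner_integral M (\<lambda>\<omega>. (W u \<omega> - W t \<omega>) $ j * (W u \<omega> - W t \<omega>) $ l)
    (if j = l then u - t else 0)"
proof (cases "j = l")
  case True
  let ?Z = "\<lambda>\<omega>. (W u \<omega> - W t \<omega>) $ j"
  note D = increment_components_normal[OF assms, of j]
  have "integrable M (\<lambda>\<omega>. (?Z \<omega>)\<^sup>2)"
    using distributed_integrable[OF D, of "\<lambda>x. x\<^sup>2"] integrable_normal_moment[of "sqrt (u - t)" 0 2] assms
    by simp
  moreover have "expectation (\<lambda>\<omega>. (?Z \<omega>)\<^sup>2) = u - t"
    using normal_distributed_variance[OF _ D] increment_moment1[OF assms, of j] assms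
    by (simp add: has_bochner_integral_iff)
  ultimately show ?thesis
    using True by (simp add: has_bochner_integral_iff power2_eq_square)
next
  case False
  have ind: "indep_vars (\<lambda>_. borel) (\<lambda>j \<omega>. (W u \<omega> - W t \<omega>) $ j) {j, l}"
    by (rule indep_vars_subset[OF increment_components_indep[OF assms]]) simp
  have "has_bochner_integral M (\<lambda>\<omega>. \<Prod>i\<in>{j, l}. (W u \<omega> - W t \<omega>) $ i)
      (\<Prod>i\<in>{j, l}. expectation (\<lambda>\<omega>. (W u \<omega> - W t \<omega>) $ i))"
    using indep_vars_lebesgue_integral[OF _ ind] indep_vars_integrable[OF _ ind] increment_moment1[OF assms]
    by (simp add: has_bochner_integral_iff)
  then show ?thesis
    using False increment_moment1[OF assms] by (simp add: has_bochner_integral_iff)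
qed

lemma mean_square_affine_increment:
  assumes "t < u"
  shows "mean_square M (\<lambda>\<omega>. y + G *v (W u \<omega> - W t \<omega>))
    = ennreal ((norm y)\<^sup>2 + (u - t) * (norm (G :: real ^ 'd ^ 'm))\<^sup>2)"
proof -
  let ?Z = "\<lambda>\<omega>. W u \<omega> - W t \<omega>"
  have row: "has_bochner_integral M (\<lambda>\<omega>. ((y + G *v ?Z \<omega>) $ i)\<^sup>2)
      ((y $ i)\<^sup>2 + (u - t) * (\<Sum>j\<in>UNIV. (G $ i $ j)\<^sup>2))" for i
  proof -
    have "has_bochner_integral M
        (\<lambda>\<omega>. (y $ i)\<^sup>2 + ((\<Sum>j\<in>UNIV. (2 * y $ i * G $ i $ j) * ?Z \<omega> $ j)
          + (\<Sum>j\<in>UNIV. \<Sum>l\<in>UNIV. (G $ i $ j * G $ i $ l) * (?Z \<omega> $ j * ?Z \<omega> $ l))))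
        ((y $ i)\<^sup>2 + ((\<Sum>j\<in>UNIV. (2 * y $ i * G $ i $ j) * 0)
          + (\<Sum>j\<in>UNIV. \<Sum>l\<in>UNIV. (G $ i $ j * G $ i $ l) * (if j = l then u - t else 0))))"
      by (intro has_bochner_integral_add has_bochner_integral_sum has_bochner_integral_mult_right
          increment_moment1 increment_moment2 assms)
        (simp add: has_bochner_integral_iff prob_space)
    moreover have "((y + G *v z) $ i)\<^sup>2 = (y $ i)\<^sup>2 + ((\<Sum>j\<in>UNIV. (2 * y $ i * G $ i $ j) * z $ j)
          + (\<Sum>j\<in>UNIV. \<Sum>l\<in>UNIV. (G $ i $ j * G $ i $ l) * (z $ j * z $ l)))" for z
    proof -
      have "((y + G *v z) $ i)\<^sup>2 = (y $ i)\<^sup>2 + 2 * y $ i * (\<Sum>j\<in>UNIV. G $ i $ j * z $ j)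
          + (\<Sum>j\<in>UNIV. G $ i $ j * z $ j) * (\<Sum>l\<in>UNIV. G $ i $ l * z $ l)"
        by (simp add: matrix_vector_mult_def power2_eq_square algebra_simps)
      then show ?thesis
        unfolding sum_product by (simp add: sum_distrib_left mult_ac)
    qed
    ultimately show ?thesis
      by (simp add: if_distrib sum_distrib_left power2_eq_square mult_ac cong: if_cong)
  qed
  have "has_bochner_integral M (\<lambda>\<omega>. (norm (y + G *v ?Z \<omega>))\<^sup>2) ((norm y)\<^sup>2 + (u - t) * (norm G)\<^sup>2)"
    using has_bochner_integral_sum[where I = UNIV, OF row]
    by (simp add: power2_norm_vec[symmetric] power2_norm_matrix sum.distrib sum_distrib_left)
      (simp add: power2_norm_vec)
  then show ?thesis
    unfolding mean_square_def
    by (subst nn_integral_eq_integral) (auto simp: has_bochner_integral_iff)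
qed

text \<open>
  A one-step Ito isometry, including the orthogonality of \<open>Y\<close> and the noise. With \<open>Y\<close> and \<open>G\<close> frozen it is a
  computation with the first two moments of a Gaussian vector.
\<close>

lemma mean_square_past_increment:
  fixes Y :: "'w \<Rightarrow> real ^ 'm" and G :: "'w \<Rightarrow> real ^ 'd ^ 'm"
  assumes "t < u" and Y: "Y \<in> borel_measurable (wiener_filtration M W t)"
    and G: "G \<in> borel_measurable (wiener_filtration M W t)"
  shows "mean_square M (\<lambda>\<omega>. Y \<omega> + G \<omega> *v (W u \<omega> - W t \<omega>))
    = (\<integral>\<^sup>+\<omega>. ennreal ((norm (Y \<omega>))\<^sup>2 + (u - t) * (norm (G \<omega>))\<^sup>2) \<partial>M)"
proof -
  \<comment> \<open>\<open>Y\<close> and \<open>G\<close> are frozen together, as one random variable.\<close>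
  have YG: "(\<lambda>\<omega>. (Y \<omega>, G \<omega>)) \<in> borel_measurable (wiener_filtration M W t)"
    using Y G by simp
  have "(\<lambda>p. snd (fst p) *v snd p) \<in> borel_measurable
      ((borel :: ((real^'m) \<times> (real^'d^'m)) measure) \<Otimes>\<^sub>M (borel :: (real^'d) measure))"
    by (rule borel_measurable_matrix_vector_mult) (simp_all add: borel_prod[symmetric])
  then have "(\<lambda>(x, z). ennreal ((norm (fst x + snd x *v z))\<^sup>2)) \<in> borel_measurable
      ((borel :: ((real^'m) \<times> (real^'d^'m)) measure) \<Otimes>\<^sub>M (borel :: (real^'d) measure))"
    by (simp add: split_beta borel_prod[symmetric])
  from nn_integral_past_increment[OF assms(1) YG this]
  show ?thesis
    by (simp add: mean_square_def mean_square_affine_increment[OF assms(1), unfolded mean_square_def])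
qed

lemma mean_square_step_diff:
  fixes X Y :: "'w \<Rightarrow> 'x::euclidean_space" and \<Phi> :: "'x \<Rightarrow> real ^ 'm" and \<Gamma> :: "'x \<Rightarrow> real ^ 'd ^ 'm"
  assumes "t < u" and X: "X \<in> borel_measurable (wiener_filtration M W t)"
    and Y: "Y \<in> borel_measurable (wiener_filtration M W t)"
    and \<Phi>: "a-lipschitz_on UNIV \<Phi>" and \<Gamma>: "b-lipschitz_on UNIV \<Gamma>"
  shows "mean_square M (\<lambda>\<omega>. (\<Phi> (X \<omega>) + \<Gamma> (X \<omega>) *v (W u \<omega> - W t \<omega>))
      - (\<Phi> (Y \<omega>) + \<Gamma> (Y \<omega>) *v (W u \<omega> - W t \<omega>)))
    \<le> ennreal (a\<^sup>2 + (u - t) * b\<^sup>2) * mean_square M (\<lambda>\<omega>. X \<omega> - Y \<omega>)"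
proof -
  let ?F = "wiener_filtration M W t"
  have m: "\<Phi> \<in> borel_measurable borel" "\<Gamma> \<in> borel_measurable borel"
    using \<Phi> \<Gamma> by (auto intro!: borel_measurable_continuous_onI lipschitz_on_continuous_on)
  note [measurable] = m measurable_wiener_filtration_ambient[OF X] measurable_wiener_filtration_ambient[OF Y]
  have D: "(\<lambda>\<omega>. \<Phi> (X \<omega>) - \<Phi> (Y \<omega>)) \<in> borel_measurable ?F" "(\<lambda>\<omega>. \<Gamma> (X \<omega>) - \<Gamma> (Y \<omega>)) \<in> borel_measurable ?F"
    using measurable_compose[OF X m(1)] measurable_compose[OF Y m(1)]
      measurable_compose[OF X m(2)] measurable_compose[OF Y m(2)] by simp_all
  have le: "(norm (\<Phi> x - \<Phi> y))\<^sup>2 + (u - t) * (norm (\<Gamma> x - \<Gamma> y))\<^sup>2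
      \<le> (a\<^sup>2 + (u - t) * b\<^sup>2) * (norm (x - y))\<^sup>2" for x y
  proof -
    have "(norm (\<Phi> x - \<Phi> y))\<^sup>2 \<le> (a * norm (x - y))\<^sup>2"
      using lipschitz_onD[OF \<Phi>, of x y] by (intro power_mono) (auto simp: dist_norm)
    moreover have "(norm (\<Gamma> x - \<Gamma> y))\<^sup>2 \<le> (b * norm (x - y))\<^sup>2"
      using lipschitz_onD[OF \<Gamma>, of x y] by (intro power_mono) (auto simp: dist_norm)
    then have "(u - t) * (norm (\<Gamma> x - \<Gamma> y))\<^sup>2 \<le> (u - t) * (b * norm (x - y))\<^sup>2"
      using \<open>t < u\<close> by (intro mult_left_mono) auto
    ultimately show ?thesis
      by (simp add: power_mult_distrib algebra_simps)
  qed
  have "mean_square M (\<lambda>\<omega>. (\<Phi> (X \<omega>) + \<Gamma> (X \<omega>) *v (W u \<omega> - W t \<omega>))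
      - (\<Phi> (Y \<omega>) + \<Gamma> (Y \<omega>) *v (W u \<omega> - W t \<omega>)))
    = mean_square M (\<lambda>\<omega>. (\<Phi> (X \<omega>) - \<Phi> (Y \<omega>)) + (\<Gamma> (X \<omega>) - \<Gamma> (Y \<omega>)) *v (W u \<omega> - W t \<omega>))"
    by (simp add: matrix_vector_mult_diff_rdistrib algebra_simps)
  also have "\<dots> = (\<integral>\<^sup>+\<omega>. ennreal ((norm (\<Phi> (X \<omega>) - \<Phi> (Y \<omega>)))\<^sup>2
      + (u - t) * (norm (\<Gamma> (X \<omega>) - \<Gamma> (Y \<omega>)))\<^sup>2) \<partial>M)"
    by (rule mean_square_past_increment[OF assms(1) D])
  also have "\<dots> \<le> (\<integral>\<^sup>+\<omega>. ennreal (a\<^sup>2 + (u - t) * b\<^sup>2) * ennreal ((norm (X \<omega> - Y \<omega>))\<^sup>2) \<partial>M)"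
    by (intro nn_integral_mono, subst ennreal_mult''[symmetric]) (auto intro!: ennreal_leI le)
  also have "\<dots> = ennreal (a\<^sup>2 + (u - t) * b\<^sup>2) * mean_square M (\<lambda>\<omega>. X \<omega> - Y \<omega>)"
    unfolding mean_square_def by (rule nn_integral_cmult) simp
  finally show ?thesis .
qed

text \<open>
  Comparison with the step from the constant \<open>0\<close>, whose second moment is known explicitly.
\<close>

lemma mean_square_step_finite:
  fixes X :: "'w \<Rightarrow> 'x::euclidean_space" and \<Phi> :: "'x \<Rightarrow> real ^ 'm" and \<Gamma> :: "'x \<Rightarrow> real ^ 'd ^ 'm"
  assumes "t < u" and X: "X \<in> borel_measurable (wiener_filtration M W t)"
    and \<Phi>: "a-lipschitz_on UNIV \<Phi>" and \<Gamma>: "b-lipschitz_on UNIV \<Gamma>"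
    and fin: "mean_square M X < \<infinity>"
  shows "mean_square M (\<lambda>\<omega>. \<Phi> (X \<omega>) + \<Gamma> (X \<omega>) *v (W u \<omega> - W t \<omega>)) < \<infinity>"
proof -
  let ?Z = "\<lambda>\<omega>. W u \<omega> - W t \<omega>"
  let ?U = "\<lambda>\<omega>. \<Phi> (X \<omega>) + \<Gamma> (X \<omega>) *v ?Z \<omega>" and ?V = "\<lambda>\<omega>. \<Phi> 0 + \<Gamma> 0 *v ?Z \<omega>"
  have m: "\<Phi> \<in> borel_measurable borel" "\<Gamma> \<in> borel_measurable borel"
    using \<Phi> \<Gamma> by (auto intro!: borel_measurable_continuous_onI lipschitz_on_continuous_on)
  note [measurable] = m measurable_wiener_filtration_ambient[OF X] measurable_increment
    borel_measurable_matrix_vector_mult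
  have "mean_square M (\<lambda>\<omega>. ?U \<omega> - ?V \<omega>) \<le> ennreal (a\<^sup>2 + (u - t) * b\<^sup>2) * mean_square M (\<lambda>\<omega>. X \<omega> - 0)"
    by (rule mean_square_step_diff[OF assms(1) X _ \<Phi> \<Gamma>]) simp
  also have "\<dots> < \<infinity>"
    using fin by (simp add: ennreal_mult_less_top)
  finally have "mean_square M (\<lambda>\<omega>. ?U \<omega> - ?V \<omega>) < \<infinity>" .
  moreover have "mean_square M ?V < \<infinity>"
    by (simp add: mean_square_affine_increment[OF assms(1)])
  moreover have "mean_square M (\<lambda>\<omega>. (?U \<omega> - ?V \<omega>) + ?V \<omega>)
      \<le> 2 * mean_square M (\<lambda>\<omega>. ?U \<omega> - ?V \<omega>) + 2 * mean_square M ?V"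
    by (rule mean_square_add_le) measurable
  ultimately show ?thesis
    by (simp add: ennreal_mult_less_top ennreal_add_less_top order_le_less_trans)
qed

end

section \<open>Contractive Euler-Maruyama schemes\<close>

text \<open>
  The matrix enters the convergence argument only through a bound \<open>\<kappa>\<close> on the norm of \<open>I + h A\<close>, and the
  smallness of the step only through the resulting contraction.
\<close>

locale contractive_euler_scheme = two_sided_wiener_process M W
  for M :: "'w measure" and W :: "real \<Rightarrow> 'w \<Rightarrow> real ^ 'd" +
  fixes \<theta> :: "real \<Rightarrow> 'w \<Rightarrow> 'w" and \<tau> :: real and n :: nat and A :: "real ^ 'm ^ 'm"
    and f :: "real \<Rightarrow> real ^ 'm \<Rightarrow> real ^ 'm" and g :: "real \<Rightarrow> real ^ 'm \<Rightarrow> real ^ 'd ^ 'm"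
    and \<kappa> \<beta>\<^sub>1 \<beta>\<^sub>2 :: real
  assumes shift: "wiener_shift M W \<theta>"
    and \<tau>_pos: "0 < \<tau>" and n_pos: "0 < n"
    and periodic_f: "f (t + \<tau>) x = f t x" and periodic_g: "g (t + \<tau>) x = g t x"
    and lipschitz_f: "\<beta>\<^sub>1-lipschitz_on UNIV (f t)" and lipschitz_g: "\<beta>\<^sub>2-lipschitz_on UNIV (g t)"
    and \<beta>\<^sub>2_pos: "0 < \<beta>\<^sub>2"
    and \<kappa>_nonneg: "0 \<le> \<kappa>"
    and linear_part: "norm (x + (\<tau> / real n) *\<^sub>R (A *v x)) \<le> \<kappa> * norm x"
    and contractive: "(\<kappa> + \<tau> / real n * \<beta>\<^sub>1)\<^sup>2 + \<tau> / real n * \<beta>\<^sub>2\<^sup>2 < 1"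
begin

definition h :: real where "h = \<tau> / real n"

definition contraction_factor :: real where "contraction_factor = (\<kappa> + h * \<beta>\<^sub>1)\<^sup>2 + h * \<beta>\<^sub>2\<^sup>2"

text \<open>
  A bound on the factor by which the final partial step, to a time between two grid points, changes
  mean-square distances. That step has no term with the matrix and is in general no contraction.
\<close>

definition interpolation_factor :: real where "interpolation_factor = (1 + h * \<beta>\<^sub>1)\<^sup>2 + h * \<beta>\<^sub>2\<^sup>2"

definition euler_drift :: "real \<Rightarrow> real ^ 'm \<Rightarrow> real ^ 'm" where
  "euler_drift t x = x + h *\<^sub>R (A *v x) + h *\<^sub>R f t x"

abbreviation iterate :: "real \<Rightarrow> ('w \<Rightarrow> real ^ 'm) \<Rightarrow> nat \<Rightarrow> 'w \<Rightarrow> real ^ 'm" where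
  "iterate \<equiv> em_iterate A f g W h"

abbreviation solution :: "nat \<Rightarrow> ('w \<Rightarrow> real ^ 'm) \<Rightarrow> real \<Rightarrow> 'w \<Rightarrow> real ^ 'm" where
  "solution \<equiv> em_solution \<tau> n A f g W"

definition steps :: "real \<Rightarrow> nat" where "steps r = nat \<lfloor>r / h\<rfloor>"

definition interpolate :: "real \<Rightarrow> real ^ 'm \<Rightarrow> 'w \<Rightarrow> real ^ 'm" where
  "interpolate r x \<omega> = (let t = real (steps r) * h in
     if r = t then x else x + (r - t) *\<^sub>R f t x + g t x *v (W r \<omega> - W t \<omega>))"

lemma h_pos: "0 < h"
  using \<tau>_pos n_pos by (simp add: h_def)

lemma n_h: "real n * h = \<tau>"
  using n_pos by (simp add: h_def)

lemma \<beta>\<^sub>1_nonneg: "0 \<le> \<beta>\<^sub>1"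
  using lipschitz_f lipschitz_on_nonneg by blast

lemma contraction_factor_bounds: "0 < contraction_factor" "contraction_factor < 1"
  using contractive h_pos \<beta>\<^sub>2_pos by (auto simp: contraction_factor_def h_def[symmetric] intro!: add_nonneg_pos)

lemma interpolation_factor_nonneg: "0 \<le> interpolation_factor"
  using h_pos by (simp add: interpolation_factor_def)

lemma interpolation_factor_ge_1: "1 \<le> interpolation_factor"
proof -
  have "1 ^ 2 \<le> (1 + h * \<beta>\<^sub>1)\<^sup>2"
    using h_pos \<beta>\<^sub>1_nonneg by (intro power_mono) auto
  then show ?thesis
    using h_pos by (simp add: interpolation_factor_def add_increasing2)
qed

lemma lipschitz_euler_drift: "(\<kappa> + h * \<beta>\<^sub>1)-lipschitz_on UNIV (euler_drift t)"
proof (rule lipschitz_onI)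
  fix x y :: "real ^ 'm"
  have "dist (euler_drift t x) (euler_drift t y)
      = norm (((x - y) + h *\<^sub>R (A *v (x - y))) + h *\<^sub>R (f t x - f t y))"
    by (simp add: dist_norm euler_drift_def matrix_vector_mult_diff_distrib algebra_simps)
  also have "\<dots> \<le> \<kappa> * norm (x - y) + h * (\<beta>\<^sub>1 * norm (x - y))"
    using lipschitz_onD[OF lipschitz_f, of x y t] linear_part[of "x - y"] h_pos
    by (intro norm_triangle_mono) (simp_all add: dist_norm h_def[symmetric])
  finally show "dist (euler_drift t x) (euler_drift t y) \<le> (\<kappa> + h * \<beta>\<^sub>1) * dist x y"
    by (simp add: dist_norm algebra_simps)
qed (use \<kappa>_nonneg h_pos \<beta>\<^sub>1_nonneg in simp)

lemma iterate_Suc: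
  "iterate s \<xi> (Suc i) \<omega> = euler_drift (real i * h) (iterate s \<xi> i \<omega>)
    + g (real i * h) (iterate s \<xi> i \<omega>) *v (W (s + real (Suc i) * h) \<omega> - W (s + real i * h) \<omega>)"
  by (simp add: Let_def euler_drift_def)

lemma solution_eq_interpolate:
  "solution k \<xi> r \<omega> = interpolate r (iterate (- real k * \<tau>) \<xi> (k * n + steps r) \<omega>) \<omega>"
  by (simp add: em_solution_def interpolate_def steps_def h_def Let_def)

lemma measurable_iterate:
  assumes "\<xi> \<in> borel_measurable (wiener_filtration M W s)"
  shows "iterate s \<xi> i \<in> borel_measurable (wiener_filtration M W (s + real i * h))"
proof (induction i)
  case 0
  have "iterate s \<xi> 0 = \<xi>"
    by (rule ext) simp
  then show ?case
    using assms by simp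
next
  case (Suc i)
  let ?F = "wiener_filtration M W (s + real (Suc i) * h)"
  have X: "iterate s \<xi> i \<in> borel_measurable ?F"
    by (rule measurable_wiener_filtration_mono[OF Suc]) (use h_pos in simp)
  have "euler_drift (real i * h) \<in> borel_measurable borel"
    by (intro borel_measurable_continuous_onI lipschitz_on_continuous_on[OF lipschitz_euler_drift])
  moreover have "g (real i * h) \<in> borel_measurable borel"
    by (intro borel_measurable_continuous_onI lipschitz_on_continuous_on[OF lipschitz_g])
  moreover have "(\<lambda>\<omega>. W (s + real (Suc i) * h) \<omega> - W (s + real i * h) \<omega>) \<in> borel_measurable ?F"
    by (rule measurable_wiener_filtration_increment) (use h_pos in auto)
  ultimately have "(\<lambda>\<omega>. euler_drift (real i * h) (iterate s \<xi> i \<omega>)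
      + g (real i * h) (iterate s \<xi> i \<omega>) *v (W (s + real (Suc i) * h) \<omega> - W (s + real i * h) \<omega>))
      \<in> borel_measurable ?F"
    by (intro borel_measurable_add borel_measurable_matrix_vector_mult measurable_compose[OF X])
  then show ?case
    unfolding iterate_Suc[abs_def] .
qed

text \<open>
  Synchronous coupling: both iterates see the same increment, which is independent of the past that
  determines them.
\<close>

lemma mean_square_iterate_diff:
  assumes "\<xi> \<in> borel_measurable (wiener_filtration M W s)" "\<eta> \<in> borel_measurable (wiener_filtration M W s)"
  shows "mean_square M (\<lambda>\<omega>. iterate s \<xi> i \<omega> - iterate s \<eta> i \<omega>)
    \<le> ennreal (contraction_factor ^ i) * mean_square M (\<lambda>\<omega>. \<xi> \<omega> - \<eta> \<omega>)"
proof (induction i)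
  case (Suc i)
  have "mean_square M (\<lambda>\<omega>. iterate s \<xi> (Suc i) \<omega> - iterate s \<eta> (Suc i) \<omega>)
      \<le> ennreal ((\<kappa> + h * \<beta>\<^sub>1)\<^sup>2 + ((s + real (Suc i) * h) - (s + real i * h)) * \<beta>\<^sub>2\<^sup>2)
        * mean_square M (\<lambda>\<omega>. iterate s \<xi> i \<omega> - iterate s \<eta> i \<omega>)"
    unfolding iterate_Suc
    by (rule mean_square_step_diff[OF _ measurable_iterate measurable_iterate lipschitz_euler_drift lipschitz_g])
      (use h_pos assms in auto)
  also have "(s + real (Suc i) * h) - (s + real i * h) = h"
    by (simp add: algebra_simps)
  also have "ennreal ((\<kappa> + h * \<beta>\<^sub>1)\<^sup>2 + h * \<beta>\<^sub>2\<^sup>2) * mean_square M (\<lambda>\<omega>. iterate s \<xi> i \<omega> - iterate s \<eta> i \<omega>)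
      \<le> ennreal contraction_factor * (ennreal (contraction_factor ^ i) * mean_square M (\<lambda>\<omega>. \<xi> \<omega> - \<eta> \<omega>))"
    unfolding contraction_factor_def[symmetric] by (rule mult_left_mono[OF Suc]) simp
  also have "\<dots> = ennreal (contraction_factor ^ Suc i) * mean_square M (\<lambda>\<omega>. \<xi> \<omega> - \<eta> \<omega>)"
    using contraction_factor_bounds by (simp add: ennreal_mult mult.assoc)
  finally show ?case .
qed simp

lemma mean_square_iterate_finite:
  assumes "\<xi> \<in> borel_measurable (wiener_filtration M W s)" "mean_square M \<xi> < \<infinity>"
  shows "mean_square M (iterate s \<xi> i) < \<infinity>"
proof (induction i)
  case 0
  have "iterate s \<xi> 0 = \<xi>"
    by (rule ext) simp
  then show ?case
    using assms by simp
next
  case (Suc i)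
  show ?case
    unfolding iterate_Suc[abs_def]
    by (rule mean_square_step_finite[OF _ measurable_iterate lipschitz_euler_drift lipschitz_g Suc])
      (use h_pos assms in auto)
qed

lemma grid_bounds:
  assumes "0 \<le> r"
  shows "real (steps r) * h \<le> r" "r < real (steps r) * h + h"
proof -
  have "real (steps r) = of_int \<lfloor>r / h\<rfloor>"
    using assms h_pos by (simp add: steps_def)
  then have "real (steps r) \<le> r / h \<and> r / h < real (steps r) + 1"
    by linarith
  then show "real (steps r) * h \<le> r" "r < real (steps r) * h + h"
    using h_pos by (simp_all add: field_simps)
qed

lemma lipschitz_interpolation_drift:
  assumes "0 \<le> s" shows "(1 + s * \<beta>\<^sub>1)-lipschitz_on UNIV (\<lambda>x. x + s *\<^sub>R f t x)"
proof (rule lipschitz_onI)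
  fix x y :: "real ^ 'm"
  have "dist (x + s *\<^sub>R f t x) (y + s *\<^sub>R f t y) = norm ((x - y) + s *\<^sub>R (f t x - f t y))"
    by (simp add: dist_norm algebra_simps)
  also have "\<dots> \<le> norm (x - y) + s * (\<beta>\<^sub>1 * norm (x - y))"
    using lipschitz_onD[OF lipschitz_f, of x y t] assms
    by (intro norm_triangle_mono) (simp_all add: dist_norm mult_left_mono)
  finally show "dist (x + s *\<^sub>R f t x) (y + s *\<^sub>R f t y) \<le> (1 + s * \<beta>\<^sub>1) * dist x y"
    by (simp add: dist_norm algebra_simps)
qed (use assms \<beta>\<^sub>1_nonneg in simp)

lemma mean_square_interpolate_diff:
  assumes r: "0 \<le> r"
    and X: "X \<in> borel_measurable (wiener_filtration M W (real (steps r) * h))"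
    and Y: "Y \<in> borel_measurable (wiener_filtration M W (real (steps r) * h))"
  shows "mean_square M (\<lambda>\<omega>. interpolate r (X \<omega>) \<omega> - interpolate r (Y \<omega>) \<omega>)
    \<le> ennreal interpolation_factor * mean_square M (\<lambda>\<omega>. X \<omega> - Y \<omega>)"
proof (cases "r = real (steps r) * h")
  case True
  have "1 * mean_square M (\<lambda>\<omega>. X \<omega> - Y \<omega>) \<le> ennreal interpolation_factor * mean_square M (\<lambda>\<omega>. X \<omega> - Y \<omega>)"
    using interpolation_factor_ge_1 by (intro mult_right_mono) auto
  with True show ?thesis
    by (simp add: interpolate_def Let_def)
next
  case False
  define t where "t = real (steps r) * h"
  have t: "t < r" "r - t \<le> h"
    using False grid_bounds[OF r] by (auto simp: t_def)
  have "mean_square M (\<lambda>\<omega>. interpolate r (X \<omega>) \<omega> - interpolate r (Y \<omega>) \<omega>)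
      \<le> ennreal ((1 + (r - t) * \<beta>\<^sub>1)\<^sup>2 + (r - t) * \<beta>\<^sub>2\<^sup>2) * mean_square M (\<lambda>\<omega>. X \<omega> - Y \<omega>)"
    using mean_square_step_diff[OF t(1) X[folded t_def] Y[folded t_def]
        lipschitz_interpolation_drift[of "r - t" t] lipschitz_g[of t]] False t
    by (simp add: interpolate_def Let_def t_def[symmetric])
  also have "(1 + (r - t) * \<beta>\<^sub>1)\<^sup>2 + (r - t) * \<beta>\<^sub>2\<^sup>2 \<le> interpolation_factor"
    unfolding interpolation_factor_def using t \<beta>\<^sub>1_nonneg
    by (intro add_mono power_mono mult_right_mono) auto
  then have "ennreal ((1 + (r - t) * \<beta>\<^sub>1)\<^sup>2 + (r - t) * \<beta>\<^sub>2\<^sup>2) * mean_square M (\<lambda>\<omega>. X \<omega> - Y \<omega>)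
      \<le> ennreal interpolation_factor * mean_square M (\<lambda>\<omega>. X \<omega> - Y \<omega>)"
    by (intro mult_right_mono ennreal_leI) auto
  finally show ?thesis .
qed

lemma mean_square_interpolate_finite:
  assumes r: "0 \<le> r"
    and X: "X \<in> borel_measurable (wiener_filtration M W (real (steps r) * h))"
    and fin: "mean_square M X < \<infinity>"
  shows "mean_square M (\<lambda>\<omega>. interpolate r (X \<omega>) \<omega>) < \<infinity>"
proof (cases "r = real (steps r) * h")
  case True
  with fin show ?thesis
    by (simp add: interpolate_def Let_def)
next
  case False
  define t where "t = real (steps r) * h"
  have t: "t < r"
    using False grid_bounds[OF r] by (auto simp: t_def)
  show ?thesis
    using mean_square_step_finite[OF t X[folded t_def]
        lipschitz_interpolation_drift[of "r - t" t] lipschitz_g[of t] fin] False t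
    by (simp add: interpolate_def Let_def t_def[symmetric])
qed

lemma measurable_interpolate:
  assumes "X \<in> borel_measurable M" "0 \<le> r"
  shows "(\<lambda>\<omega>. interpolate r (X \<omega>) \<omega>) \<in> borel_measurable M"
proof (cases "r = real (steps r) * h")
  case True
  with assms show ?thesis
    by (simp add: interpolate_def Let_def)
next
  case False
  define t where "t = real (steps r) * h"
  have [measurable]: "f t \<in> borel_measurable borel" "g t \<in> borel_measurable borel"
    by (intro borel_measurable_continuous_onI lipschitz_on_continuous_on[OF lipschitz_f]
        borel_measurable_continuous_onI lipschitz_on_continuous_on[OF lipschitz_g])+
  note [measurable] = assms(1) measurable_increment borel_measurable_matrix_vector_mult
  have "(\<lambda>\<omega>. X \<omega> + (r - t) *\<^sub>R f t (X \<omega>) + g t (X \<omega>) *v (W r \<omega> - W t \<omega>)) \<in> borel_measurable M"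
    by measurable
  with False show ?thesis
    by (simp add: interpolate_def Let_def t_def[symmetric])
qed

lemma measurable_last_iterate:
  assumes "\<xi> \<in> borel_measurable (wiener_filtration M W (- real k * \<tau>))"
  shows "iterate (- real k * \<tau>) \<xi> (k * n + steps r) \<in> borel_measurable (wiener_filtration M W (real (steps r) * h))"
proof -
  have "- real k * \<tau> + real (k * n + steps r) * h = real (steps r) * h"
    by (simp add: distrib_right mult.assoc n_h)
  then show ?thesis
    using measurable_iterate[OF assms, of "k * n + steps r"] by simp
qed

lemma measurable_solution:
  assumes "\<xi> \<in> borel_measurable (wiener_filtration M W (- real k * \<tau>))" "0 \<le> r"
  shows "solution k \<xi> r \<in> borel_measurable M"
  unfolding solution_eq_interpolate[abs_def]
  using measurable_interpolate[OF measurable_wiener_filtration_ambient[OF measurable_last_iterate[OF assms(1)]] assms(2)] .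

lemma mean_square_solution_diff:
  assumes \<xi>: "\<xi> \<in> borel_measurable (wiener_filtration M W (- real k * \<tau>))"
    and \<eta>: "\<eta> \<in> borel_measurable (wiener_filtration M W (- real k * \<tau>))" and r: "0 \<le> r"
  shows "mean_square M (\<lambda>\<omega>. solution k \<xi> r \<omega> - solution k \<eta> r \<omega>)
    \<le> ennreal (interpolation_factor * (contraction_factor ^ n) ^ k) * mean_square M (\<lambda>\<omega>. \<xi> \<omega> - \<eta> \<omega>)"
proof -
  let ?i = "k * n + steps r"
  have "mean_square M (\<lambda>\<omega>. solution k \<xi> r \<omega> - solution k \<eta> r \<omega>)
      \<le> ennreal interpolation_factor * mean_square M (\<lambda>\<omega>. iterate (- real k * \<tau>) \<xi> ?i \<omega> - iterate (- real k * \<tau>) \<eta> ?i \<omega>)"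
    unfolding solution_eq_interpolate
    by (rule mean_square_interpolate_diff[OF r measurable_last_iterate[OF \<xi>] measurable_last_iterate[OF \<eta>]])
  also have "\<dots> \<le> ennreal interpolation_factor * (ennreal (contraction_factor ^ ?i) * mean_square M (\<lambda>\<omega>. \<xi> \<omega> - \<eta> \<omega>))"
    by (intro mult_left_mono mean_square_iterate_diff \<xi> \<eta>) simp
  also have "\<dots> = ennreal (interpolation_factor * contraction_factor ^ ?i) * mean_square M (\<lambda>\<omega>. \<xi> \<omega> - \<eta> \<omega>)"
    using contraction_factor_bounds interpolation_factor_nonneg by (simp add: ennreal_mult mult.assoc)
  also have "\<dots> \<le> ennreal (interpolation_factor * (contraction_factor ^ n) ^ k) * mean_square M (\<lambda>\<omega>. \<xi> \<omega> - \<eta> \<omega>)"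
    unfolding power_mult[symmetric] using contraction_factor_bounds interpolation_factor_nonneg
    by (intro mult_right_mono ennreal_leI mult_left_mono power_decreasing) (auto simp: mult.commute)
  finally show ?thesis .
qed

lemma W_shift:
  assumes "\<omega> \<in> space M"
  shows "W u (\<theta> t \<omega>) - W v (\<theta> t \<omega>) = W (t + u) \<omega> - W (t + v) \<omega>"
  using shift assms by (simp add: wiener_shift_def)

lemma iterate_shift:
  assumes "\<omega> \<in> space M"
  shows "iterate s \<xi> i (\<theta> t \<omega>) = iterate (t + s) (\<lambda>\<omega>. \<xi> (\<theta> t \<omega>)) i \<omega>"
proof (induction i)
  case (Suc i)
  show ?case
    unfolding iterate_Suc Suc W_shift[OF assms] by (simp add: add.assoc)
qed simp

text \<open>
  The coefficients are evaluated at the time elapsed since the start. Their periodicity makes a restart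
  after \<open>n\<close> steps, which is one full period, invisible.
\<close>

lemma iterate_restart:
  "iterate s \<xi> (n + i) \<omega> = iterate (s + \<tau>) (iterate s \<xi> n) i \<omega>"
proof (induction i)
  case (Suc i)
  have "real (n + i) * h = real i * h + \<tau>"
    by (simp add: distrib_right n_h)
  moreover have "s + real (Suc (n + i)) * h = s + \<tau> + real (Suc i) * h"
    by (simp add: distrib_right n_h)
  moreover have periodic: "f (\<tau> + t) x = f t x" "g (\<tau> + t) x = g t x" for t x
    using periodic_f[of t x] periodic_g[of t x] by (simp_all add: add.commute)
  ultimately show ?case
    unfolding add_Suc_right iterate_Suc Suc euler_drift_def
    by (simp add: periodic add_ac)
qed simp

lemma mean_square_shift:
  assumes "X \<in> borel_measurable M"
  shows "mean_square M (\<lambda>\<omega>. X (\<theta> t \<omega>)) = mean_square M X"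
proof -
  have \<theta>: "\<theta> t \<in> measurable M M" "distr M M (\<theta> t) = M"
    using shift by (auto simp: wiener_shift_def)
  note [measurable] = assms
  have "mean_square (distr M M (\<theta> t)) X = mean_square M (\<lambda>\<omega>. X (\<theta> t \<omega>))"
    unfolding mean_square_def by (rule nn_integral_distr[OF \<theta>(1)]) simp
  then show ?thesis
    by (simp add: \<theta>(2))
qed

abbreviation solution0 :: "nat \<Rightarrow> real \<Rightarrow> 'w \<Rightarrow> real ^ 'm" where
  "solution0 k \<equiv> solution k (\<lambda>_. 0)"

text \<open>
  The value after one period depends on the starting time only through a shift of the path, and the
  shift preserves the measure.
\<close>

lemma mean_square_one_period:
  "\<exists>b\<ge>0. \<forall>s. mean_square M (iterate s (\<lambda>_. 0) n) = ennreal b"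
proof -
  have m: "iterate 0 (\<lambda>_. 0) n \<in> borel_measurable M"
    by (rule measurable_wiener_filtration_ambient[OF measurable_iterate]) simp
  have "mean_square M (iterate s (\<lambda>_. 0) n) = mean_square M (iterate 0 (\<lambda>_. 0) n)" for s
  proof -
    have "mean_square M (iterate s (\<lambda>_. 0) n) = mean_square M (\<lambda>\<omega>. iterate 0 (\<lambda>_. 0) n (\<theta> s \<omega>))"
      unfolding mean_square_def by (rule nn_integral_cong) (simp add: iterate_shift)
    also have "\<dots> = mean_square M (iterate 0 (\<lambda>_. 0) n)"
      by (rule mean_square_shift[OF m])
    finally show ?thesis .
  qed
  moreover have "mean_square M (iterate 0 (\<lambda>_. 0) n) < \<infinity>"
    by (rule mean_square_iterate_finite) (simp_all add: mean_square_def)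
  ultimately show ?thesis
    by (metis ennreal_cases infinity_ennreal_def less_irrefl)
qed

lemma solution0_Suc:
  "solution0 (Suc k) r \<omega> = solution k (iterate (- real (Suc k) * \<tau>) (\<lambda>_. 0) n) r \<omega>"
proof -
  have "Suc k * n + steps r = n + (k * n + steps r)" "- real (Suc k) * \<tau> + \<tau> = - real k * \<tau>"
    by (simp_all add: algebra_simps)
  then show ?thesis
    unfolding solution_eq_interpolate by (simp only: iterate_restart)
qed

text \<open>
  By \<open>solution0_Suc\<close> both solutions start at \<open>- k \<tau>\<close>, one with the value reached after one period and the
  other with \<open>0\<close>, and contraction applies.
\<close>

lemma solution0_increment:
  obtains b where "0 \<le> b" and "\<And>k r. 0 \<le> r \<Longrightarrow>
    mean_square M (\<lambda>\<omega>. solution0 (Suc k) r \<omega> - solution0 k r \<omega>) \<le> ennreal (b * (contraction_factor ^ n) ^ k)"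
proof -
  obtain b where b: "0 \<le> b" "\<And>s. mean_square M (iterate s (\<lambda>_. 0) n) = ennreal b"
    using mean_square_one_period by blast
  have "mean_square M (\<lambda>\<omega>. solution0 (Suc k) r \<omega> - solution0 k r \<omega>) \<le> ennreal (interpolation_factor * b * (contraction_factor ^ n) ^ k)"
    if r: "0 \<le> r" for k r
  proof -
    let ?s = "- real (Suc k) * \<tau>"
    have "?s + real n * h = - real k * \<tau>"
      by (simp add: n_h algebra_simps)
    then have "iterate ?s (\<lambda>_. 0) n \<in> borel_measurable (wiener_filtration M W (- real k * \<tau>))"
      using measurable_iterate[of "\<lambda>_. 0" ?s n] by simp
    from mean_square_solution_diff[OF this _ r, of "\<lambda>_. 0"]
    have "mean_square M (\<lambda>\<omega>. solution0 (Suc k) r \<omega> - solution0 k r \<omega>)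
        \<le> ennreal (interpolation_factor * (contraction_factor ^ n) ^ k) * ennreal b"
      unfolding solution0_Suc by (simp add: b(2))
    also have "\<dots> = ennreal (interpolation_factor * b * (contraction_factor ^ n) ^ k)"
      by (subst ennreal_mult''[symmetric]) (simp_all add: b(1) mult_ac)
    finally show ?thesis .
  qed
  moreover have "0 \<le> interpolation_factor * b"
    using b(1) interpolation_factor_nonneg by simp
  ultimately show ?thesis
    using that by blast
qed

text \<open>
  A pathwise limit, with an unspecified value where the sequence diverges. Having a version defined for
  every path is what makes the periodicity an identity of sequences.
\<close>

definition pullback_limit :: "real \<Rightarrow> 'w \<Rightarrow> real ^ 'm" where
  "pullback_limit r \<omega> = lim (\<lambda>k. solution0 k r \<omega>)"

text \<open>
  The solution at \<open>r + \<tau>\<close> that starts at \<open>- k \<tau>\<close> is the solution at \<open>r\<close> that starts at \<open>- (k + 1) \<tau>\<close>,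
  evaluated at the shifted path. Dropping the first member of a sequence changes neither its
  convergence nor its limit.
\<close>

lemma pullback_limit_periodic:
  assumes "0 \<le> r" "\<omega> \<in> space M"
  shows "pullback_limit (r + \<tau>) \<omega> = pullback_limit r (\<theta> \<tau> \<omega>)"
proof -
  have h_ne: "h \<noteq> 0"
    using h_pos by simp
  have "\<tau> / h = real n"
    using h_ne n_h by (simp add: divide_eq_eq)
  then have "(r + \<tau>) / h = r / h + of_int (int n)"
    by (simp add: add_divide_distrib)
  then have "\<lfloor>(r + \<tau>) / h\<rfloor> = \<lfloor>r / h\<rfloor> + int n"
    by (metis floor_add_int)
  then have steps: "steps (r + \<tau>) = n + steps r"
    using assms(1) h_pos by (simp add: steps_def nat_add_distrib)
  have time: "real (steps (r + \<tau>)) * h = real (steps r) * h + \<tau>"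
    by (simp add: steps distrib_right n_h)
  have interp: "interpolate (r + \<tau>) x \<omega> = interpolate r x (\<theta> \<tau> \<omega>)" for x
    unfolding interpolate_def time W_shift[OF assms(2)]
    by (simp add: Let_def periodic_f periodic_g add.commute[of \<tau>])
  have "solution0 k (r + \<tau>) \<omega> = solution0 (Suc k) r (\<theta> \<tau> \<omega>)" for k
  proof -
    have "\<tau> + - real (Suc k) * \<tau> = - real k * \<tau>" "k * n + (n + steps r) = Suc k * n + steps r"
      by (simp_all add: algebra_simps)
    then show ?thesis
      unfolding solution_eq_interpolate iterate_shift[OF assms(2)] interp steps by (simp add: add_ac)
  qed
  then have "pullback_limit (r + \<tau>) \<omega> = lim (\<lambda>k. solution0 (Suc k) r (\<theta> \<tau> \<omega>))"
    by (simp add: pullback_limit_def)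
  also have "\<dots> = lim (\<lambda>k. solution0 k r (\<theta> \<tau> \<omega>))"
    unfolding lim_def by (simp only: filterlim_sequentially_Suc[of "\<lambda>k. solution0 k r (\<theta> \<tau> \<omega>)"])
  finally show ?thesis
    by (simp add: pullback_limit_def)
qed

lemma measurable_pullback_limit:
  assumes "0 \<le> r" shows "pullback_limit r \<in> borel_measurable M"
  unfolding pullback_limit_def[abs_def]
  by (rule borel_measurable_lim_metric) (rule measurable_solution[OF _ assms], simp)

lemma mean_square_solution0_pullback_limit:
  assumes r: "0 \<le> r"
  obtains C p where "0 \<le> C" "0 < p" "p < 1"
    and "\<And>k. mean_square M (\<lambda>\<omega>. solution0 k r \<omega> - pullback_limit r \<omega>) \<le> ennreal (C * p ^ k)"
proof -
  obtain b where b: "0 \<le> b" "\<And>k. mean_square M (\<lambda>\<omega>. solution0 (Suc k) r \<omega> - solution0 k r \<omega>)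
      \<le> ennreal (b * (contraction_factor ^ n) ^ k)"
    using solution0_increment r by metis
  \<comment> \<open>Half of the exponential rate of contraction is spent on the weights of the squared steps.\<close>
  define p where "p = sqrt (contraction_factor ^ n)"
  have "contraction_factor ^ n < 1"
    using contraction_factor_bounds n_pos by (simp add: power_less_one_iff)
  then have p: "0 < p" "p < 1" "p\<^sup>2 = contraction_factor ^ n"
    using contraction_factor_bounds by (auto simp: p_def)
  have m: "solution0 k r \<in> borel_measurable M" for k
    by (rule measurable_solution[OF _ r]) simp
  have "mean_square M (\<lambda>\<omega>. solution0 k r \<omega> - pullback_limit r \<omega>)
      \<le> ennreal (p ^ k / (1 - p) * (b / (1 - p)))" for k
    unfolding pullback_limit_def by (intro mean_square_lim_le m p b(1) b(2)[folded p(3)])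
  then have "mean_square M (\<lambda>\<omega>. solution0 k r \<omega> - pullback_limit r \<omega>)
      \<le> ennreal (b / (1 - p) / (1 - p) * p ^ k)" for k
    by (simp add: mult_ac)
  with b p show ?thesis
    by (intro that[of "b / (1 - p) / (1 - p)" p]) auto
qed

text \<open>
  The limit has finite distance in mean square to the solution with \<open>k = 0\<close>, which is square-integrable.
\<close>

lemma pullback_limit_in_L2:
  assumes r: "0 \<le> r"
  shows "pullback_limit r \<in> L2_space M"
proof -
  obtain C p where "mean_square M (\<lambda>\<omega>. solution0 0 r \<omega> - pullback_limit r \<omega>) \<le> ennreal (C * p ^ 0)"
    using mean_square_solution0_pullback_limit[OF r] by metis
  then have "mean_square M (\<lambda>\<omega>. solution0 0 r \<omega> - pullback_limit r \<omega>) < \<infinity>"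
    by (simp add: order_le_less_trans)
  moreover have "mean_square M (\<lambda>\<omega>. solution0 0 r \<omega> - pullback_limit r \<omega>)
      = mean_square M (\<lambda>\<omega>. pullback_limit r \<omega> - solution0 0 r \<omega>)"
    by (simp add: mean_square_def norm_minus_commute)
  moreover have "mean_square M (solution0 0 r) < \<infinity>"
    unfolding solution_eq_interpolate[abs_def]
    by (intro mean_square_interpolate_finite[OF r] measurable_last_iterate mean_square_iterate_finite)
      (simp_all add: mean_square_def)
  moreover have m: "solution0 0 r \<in> borel_measurable M"
    by (rule measurable_solution[OF _ r]) simp
  have "mean_square M (\<lambda>\<omega>. (pullback_limit r \<omega> - solution0 0 r \<omega>) + solution0 0 r \<omega>)
      \<le> 2 * mean_square M (\<lambda>\<omega>. pullback_limit r \<omega> - solution0 0 r \<omega>) + 2 * mean_square M (solution0 0 r)"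
    using m measurable_pullback_limit[OF r] by (intro mean_square_add_le) simp_all
  ultimately have "mean_square M (pullback_limit r) < \<infinity>"
    by (simp add: ennreal_mult_less_top ennreal_add_less_top order_le_less_trans)
  then show ?thesis
    using measurable_pullback_limit[OF r] by (simp add: L2_space_def Lp_norm_2_eq)
qed

text \<open>
  Both the distance of the solution to the one started at \<open>0\<close> and the distance of the latter to the limit
  decay geometrically.
\<close>

lemma solution_tendsto_pullback_limit:
  assumes r: "0 \<le> r"
    and \<xi>: "\<And>k. \<xi> \<in> borel_measurable (wiener_filtration M W (- real k * \<tau>))"
    and fin: "mean_square M \<xi> < \<infinity>"
  shows "(\<lambda>k. Lp_norm M 2 (\<lambda>\<omega>. solution k \<xi> r \<omega> - pullback_limit r \<omega>)) \<longlonglongrightarrow> 0"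
proof -
  obtain C p where C: "0 \<le> C" "0 < p" "p < 1"
    "\<And>k. mean_square M (\<lambda>\<omega>. solution0 k r \<omega> - pullback_limit r \<omega>) \<le> ennreal (C * p ^ k)"
    using mean_square_solution0_pullback_limit[OF r] by metis
  obtain a where a: "mean_square M \<xi> = ennreal a" "0 \<le> a"
    using fin by (cases "mean_square M \<xi>") auto
  have m: "solution k \<xi> r \<in> borel_measurable M" "solution0 k r \<in> borel_measurable M" for k
    by (rule measurable_solution[OF \<xi> r], rule measurable_solution[OF _ r], simp)
  define e where "e k = 2 * (interpolation_factor * (contraction_factor ^ n) ^ k * a) + 2 * (C * p ^ k)" for k
  have e_nonneg: "0 \<le> e k" for k
    using a C contraction_factor_bounds interpolation_factor_nonneg by (simp add: e_def)
  have le: "mean_square M (\<lambda>\<omega>. solution k \<xi> r \<omega> - pullback_limit r \<omega>) \<le> ennreal (e k)" for k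
  proof -
    have "mean_square M (\<lambda>\<omega>. solution k \<xi> r \<omega> - solution0 k r \<omega>)
        \<le> ennreal (interpolation_factor * (contraction_factor ^ n) ^ k) * ennreal a"
      using mean_square_solution_diff[OF \<xi> _ r, of "\<lambda>_. 0" k] by (simp add: a)
    also have "\<dots> = ennreal (interpolation_factor * (contraction_factor ^ n) ^ k * a)"
      using a by (simp add: ennreal_mult'')
    finally have 1: "mean_square M (\<lambda>\<omega>. solution k \<xi> r \<omega> - solution0 k r \<omega>) \<le> \<dots>" .
    have "mean_square M (\<lambda>\<omega>. (solution k \<xi> r \<omega> - solution0 k r \<omega>) + (solution0 k r \<omega> - pullback_limit r \<omega>))
        \<le> 2 * mean_square M (\<lambda>\<omega>. solution k \<xi> r \<omega> - solution0 k r \<omega>)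
          + 2 * mean_square M (\<lambda>\<omega>. solution0 k r \<omega> - pullback_limit r \<omega>)"
      using m measurable_pullback_limit[OF r] by (intro mean_square_add_le) simp_all
    also have "\<dots> \<le> 2 * ennreal (interpolation_factor * (contraction_factor ^ n) ^ k * a) + 2 * ennreal (C * p ^ k)"
      by (intro add_mono mult_left_mono 1 C) auto
    also have "\<dots> = ennreal (e k)"
      using a C contraction_factor_bounds interpolation_factor_nonneg by (simp add: e_def ennreal_mult)
    finally show ?thesis
      by simp
  qed
  have "contraction_factor ^ n < 1"
    using contraction_factor_bounds n_pos by (simp add: power_less_one_iff)
  then have "e \<longlonglongrightarrow> 2 * (interpolation_factor * 0 * a) + 2 * (C * 0)"
    unfolding e_def[abs_def] using C contraction_factor_bounds by (intro tendsto_intros LIMSEQ_realpow_zero) auto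
  then have "(\<lambda>k. sqrt (e k)) \<longlonglongrightarrow> sqrt 0"
    by (intro tendsto_real_sqrt) simp
  then have lim: "(\<lambda>k. ennreal (sqrt (e k))) \<longlonglongrightarrow> 0"
    using tendsto_ennrealI[of "\<lambda>k. sqrt (e k)" 0] by simp
  show ?thesis
    by (rule tendsto_sandwich[OF _ _ tendsto_const lim])
      (simp_all add: Lp_norm_2_le le e_nonneg)
qed

end

theorem theorem3p4:
  fixes M :: "'w measure" and W :: "real \<Rightarrow> 'w \<Rightarrow> real ^ 'd" and \<theta> :: "real \<Rightarrow> 'w \<Rightarrow> 'w"
    and \<tau> :: real and A :: "real ^ 'm ^ 'm" and eig :: "nat \<Rightarrow> real"
    and f :: "real \<Rightarrow> real ^ 'm \<Rightarrow> real ^ 'm" and g :: "real \<Rightarrow> real ^ 'm \<Rightarrow> real ^ 'd ^ 'm"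
    and C\<^sub>0 \<beta>\<^sub>1 \<beta>\<^sub>2 :: real
  assumes "two_sided_wiener_process M W" and "wiener_shift M W \<theta>"
    and "\<tau> > 0"
    and "transpose A = A" and "ordered_eigenvalues A eig" and "eig 1 < 0"
    and "\<And>t x. f (t + \<tau>) x = f t x" and "\<And>t x. g (t + \<tau>) x = g t x"
    and "C\<^sub>0 > 0" and "\<beta>\<^sub>1 > 0" and "\<beta>\<^sub>2 > 0" and "\<beta>\<^sub>1 + \<beta>\<^sub>2\<^sup>2 / 2 < \<bar>eig 1\<bar>"
    and "\<And>s t x y. norm (f s x - f t y) \<le> C\<^sub>0 * \<bar>s - t\<bar> powr (1 / 2) + \<beta>\<^sub>1 * norm (x - y)"
    and "\<And>s t x y. norm (g s x - g t y) \<le> C\<^sub>0 * \<bar>s - t\<bar> powr (1 / 2) + \<beta>\<^sub>2 * norm (x - y)"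
  shows "\<exists>\<delta>>0. \<forall>n::nat. n > 0 \<and> \<tau> / real n \<le> 1 / \<bar>eig CARD('m)\<bar> \<and> \<tau> / real n \<le> \<delta> \<longrightarrow>
    (\<exists>Xstar :: real \<Rightarrow> 'w \<Rightarrow> real ^ 'm.
      (\<forall>r\<ge>0. Xstar r \<in> L2_space M \<and>
        (\<forall>\<xi>. (\<forall>k::nat. \<xi> \<in> borel_measurable (wiener_filtration M W (- real k * \<tau>))) \<and>
             (\<exists>K>0. Lp_norm M 2 \<xi> \<le> ennreal K) \<longrightarrow>
             (\<lambda>k. Lp_norm M 2 (\<lambda>\<omega>. em_solution \<tau> n A f g W k \<xi> r \<omega> - Xstar r \<omega>))
               \<longlonglongrightarrow> 0)) \<and>
      (\<forall>r\<ge>0. AE \<omega> in M. Xstar (r + \<tau>) \<omega> = Xstar r (\<theta> \<tau> \<omega>)))"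
proof -
  define a where "a = - eig 1 - \<beta>\<^sub>1"
  \<comment> \<open>The contraction factor is \<open>1 - 2 h \<alpha> + h\<^sup>2 a\<^sup>2\<close>, which is at most \<open>1 - h \<alpha>\<close> for \<open>h \<le> \<alpha> / a\<^sup>2\<close>.\<close>
  define \<alpha> where "\<alpha> = a - \<beta>\<^sub>2\<^sup>2 / 2"
  have \<alpha>: "0 < \<alpha>"
    using assms(6,12) by (simp add: \<alpha>_def a_def)
  then have a: "0 < a"
    using zero_le_power2[of \<beta>\<^sub>2] unfolding \<alpha>_def by linarith
  have lip_f: "\<beta>\<^sub>1-lipschitz_on UNIV (f t)" for t
    using assms(13)[of t _ t] assms(10) by (intro lipschitz_onI) (simp_all add: dist_norm)
  have lip_g: "\<beta>\<^sub>2-lipschitz_on UNIV (g t)" for t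
    using assms(14)[of t _ t] assms(11) by (intro lipschitz_onI) (simp_all add: dist_norm)
  show ?thesis
  proof (intro exI[of _ "\<alpha> / a\<^sup>2"] conjI allI impI)
    show "0 < \<alpha> / a\<^sup>2"
      using \<alpha> a by simp
    fix n :: nat
    assume n: "0 < n \<and> \<tau> / real n \<le> 1 / \<bar>eig CARD('m)\<bar> \<and> \<tau> / real n \<le> \<alpha> / a\<^sup>2"
    define h where "h = \<tau> / real n"
    have h: "0 < h" "h \<le> 1 / \<bar>eig CARD('m)\<bar>" "h * a\<^sup>2 \<le> \<alpha>"
      using n assms(3) a by (simp_all add: h_def pos_le_divide_eq)
    have "(1 + h * eig 1 + h * \<beta>\<^sub>1)\<^sup>2 + h * \<beta>\<^sub>2\<^sup>2 = 1 - 2 * (h * \<alpha>) + h * (h * a\<^sup>2)"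
      by (simp add: \<alpha>_def a_def power2_eq_square algebra_simps)
    also have "\<dots> \<le> 1 - h * \<alpha>"
      using mult_left_mono[OF h(3), of h] h(1) by simp
    also have "\<dots> < 1"
      using h(1) \<alpha> by simp
    finally have contr: "(1 + h * eig 1 + h * \<beta>\<^sub>1)\<^sup>2 + h * \<beta>\<^sub>2\<^sup>2 < 1" .
    interpret W: two_sided_wiener_process M W
      by fact
    interpret S: contractive_euler_scheme M W \<theta> \<tau> n A f g "1 + h * eig 1" \<beta>\<^sub>1 \<beta>\<^sub>2
      using norm_euler_map_le[OF assms(4-6) h(1,2)] contr n
      by unfold_locales (simp_all add: assms h_def lip_f lip_g)
    show "\<exists>Xstar :: real \<Rightarrow> 'w \<Rightarrow> real ^ 'm.
      (\<forall>r\<ge>0. Xstar r \<in> L2_space M \<and>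
        (\<forall>\<xi>. (\<forall>k::nat. \<xi> \<in> borel_measurable (wiener_filtration M W (- real k * \<tau>))) \<and>
             (\<exists>K>0. Lp_norm M 2 \<xi> \<le> ennreal K) \<longrightarrow>
             (\<lambda>k. Lp_norm M 2 (\<lambda>\<omega>. em_solution \<tau> n A f g W k \<xi> r \<omega> - Xstar r \<omega>))
               \<longlonglongrightarrow> 0)) \<and>
      (\<forall>r\<ge>0. AE \<omega> in M. Xstar (r + \<tau>) \<omega> = Xstar r (\<theta> \<tau> \<omega>))"
      using S.pullback_limit_in_L2 S.solution_tendsto_pullback_limit mean_square_finite_if_Lp_norm_le
        S.pullback_limit_periodic
      by (intro exI[of _ S.pullback_limit]) (blast intro: AE_I2)
  qed
qed

end
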